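(* There is an algorithm that decides Seg-Agony in $\tau\,(\ell n)^{O(n)}\log W$ time, where, for an instance $(\mathcal{G},k,\ell,\alpha)$ with $\ell\ge 1$ and $\mathcal{G}=(V,(A_t)_{t\in[\tau]},(w_t)_{t\in[\tau]})$, $n=|V|$ is the number of vertices, $\tau$ is the lifetime of $\mathcal{G}$, $\ell$ is the number of allowed rank changes per vertex, and $W$ is the maximum arc weight occurring in $\mathcal{G}$.
   Context: Notation: $\mathbb{N}$ includes $0$, $\mathbb{N}^+=\mathbb{N}\setminus\{0\}$, $[m]=\{1,\ldots,m\}$. A temporal weighted digraph $\mathcal{G}=(V,(A_t)_{t\in[\tau]},(w_t)_{t\in[\tau]})$ with lifetime $\tau$ consists of a finite vertex set $V$, arc sets $A_1,\ldots,A_\tau\subseteq V^2$, and weight functions $w_t\colon A_t\to\mathbb{N}^+$. For $k,\ell\in\mathbb{N}$, a map $r\colon V\times[\tau]\to[k]$ is a rank $\ell$-segmentation if there are functions $r_0,\ldots,r_\ell\colon V\to[k]$ and $c\colon V\times[\ell]\to[\tau]$ with $c(v,i)\le c(v,i+1)$ for all $v\in V$, $i\in[\ell-1]$, such that for all $v\in V$, $t\in[\tau]$: $r(v,t)=r_0(v)$ if $t<c(v,1)$; $r(v,t)=r_i(v)$ if $c(v,i)\le t<c(v,i+1)$ for $1\le i<\ell$; and $r(v,t)=r_\ell(v)$ if $c(v,\ell)\le t$. (That is, each vertex changes its rank at most $\ell$ times.) Let $p_l\colon\mathbb{Z}\to\mathbb{N}$, $p_l(x)=\max(0,x+1)$.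 The temporal agony of $r$ is $$q(r,\mathcal{G},p_l)=\sum_{t\in[\tau]}\sum_{(u,v)\in A_t}w_t(u,v)\,p_l(r(u,t)-r(v,t)).$$ Seg-Agony: given a temporal weighted digraph $\mathcal{G}$ and $k,\ell,\alpha\in\mathbb{N}$, decide whether there is a rank $\ell$-segmentation $r\colon V\times[\tau]\to[k]$ with $q(r,\mathcal{G},p_l)\le\alpha$. Convention: as usual in running-time bounds, logarithmic factors such as $\log W$ are understood to be at least $1$. *)

theory Defs
  imports Complex_Main "HOL-Library.Log_Nat"
begin

section \<open>Temporal weighted digraphs and segmented agony\<close>

text \<open>Time steps are \<open>1, \<dots>, lifetime G\<close>; arcs and weights at other indices are irrelevant junk.\<close>

record 'v tgraph =
  verts :: "'v set"
  lifetime :: nat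
  arcs :: "nat \<Rightarrow> ('v \<times> 'v) set"
  weight :: "nat \<Rightarrow> 'v \<times> 'v \<Rightarrow> nat"

definition temporal_wdigraph :: "'v tgraph \<Rightarrow> bool" where
  "temporal_wdigraph G \<longleftrightarrow>
     finite (verts G) \<and>
     (\<forall>t\<in>{1..lifetime G}. arcs G t \<subseteq> verts G \<times> verts G) \<and>
     (\<forall>t\<in>{1..lifetime G}. \<forall>a\<in>arcs G t. 1 \<le> weight G t a)"

text \<open>The disjunct \<open>l = 0\<close> covers the case in which the change point \<open>c v 1\<close> does not exist:
  the rank of every vertex is then constant.\<close>

definition rank_segmentation ::
    "'v set \<Rightarrow> nat \<Rightarrow> nat \<Rightarrow> nat \<Rightarrow> ('v \<Rightarrow> nat \<Rightarrow> nat) \<Rightarrow> bool" where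
  "rank_segmentation V \<tau> k l r \<longleftrightarrow>
     (\<forall>v\<in>V. \<forall>t\<in>{1..\<tau>}. r v t \<in> {1..k}) \<and>
     (\<exists>(rs :: nat \<Rightarrow> 'v \<Rightarrow> nat) (c :: 'v \<Rightarrow> nat \<Rightarrow> nat).
        (\<forall>i\<in>{0..l}. \<forall>v\<in>V. rs i v \<in> {1..k}) \<and>
        (\<forall>v\<in>V. \<forall>i\<in>{1..l}. c v i \<in> {1..\<tau>}) \<and>
        (\<forall>v\<in>V. \<forall>i\<in>{1..<l}. c v i \<le> c v (i + 1)) \<and>
        (\<forall>v\<in>V. \<forall>t\<in>{1..\<tau>}.
           (l = 0 \<or> t < c v 1 \<longrightarrow> r v t = rs 0 v) \<and>
           (\<forall>i\<in>{1..<l}. c v i \<le> t \<and> t < c v (i + 1) \<longrightarrow> r v t = rs i v) \<and>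
           (1 \<le> l \<and> c v l \<le> t \<longrightarrow> r v t = rs l v)))"

definition linear_penalty :: "int \<Rightarrow> nat" where
  "linear_penalty x = nat (max 0 (x + 1))"

definition temporal_agony :: "('v \<Rightarrow> nat \<Rightarrow> nat) \<Rightarrow> 'v tgraph \<Rightarrow> (int \<Rightarrow> nat) \<Rightarrow> nat" where
  "temporal_agony r G p =
     (\<Sum>t\<in>{1..lifetime G}. \<Sum>(u, v)\<in>arcs G t.
        weight G t (u, v) * p (int (r u t) - int (r v t)))"

definition seg_agony :: "'v tgraph \<Rightarrow> nat \<Rightarrow> nat \<Rightarrow> nat \<Rightarrow> bool" where
  "seg_agony G k l \<alpha> \<longleftrightarrow>
     (\<exists>r. rank_segmentation (verts G) (lifetime G) k l r \<and>
          temporal_agony r G linear_penalty \<le> \<alpha>)"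

text \<open>Inserting \<open>1\<close> only fixes the value for graphs without any arc, since weights are positive.\<close>

definition max_weight :: "'v tgraph \<Rightarrow> nat" where
  "max_weight G = Max (insert 1 (\<Union>t\<in>{1..lifetime G}. weight G t ` arcs G t))"


section \<open>Random access machines\<close>

text \<open>
  A random access machine with addition, truncated subtraction and comparison, but without
  multiplication. It has a register file, addressed directly by the program, and a memory,
  addressed indirectly through registers. Cells hold natural numbers of any size, stored as sequences
  of \<open>b\<close>-bit machine words; an instruction is charged the number of words it has to read.
  Thus an operation on numbers that fit into one word takes constant time, whereas arithmetic
  on a number \<open>x\<close> takes time proportional to \<open>log x / b\<close>.
  The program itself does not depend on \<open>b\<close>.
\<close>

datatype instr =
    Const nat nat        \<comment> \<open>\<open>R[i] := c\<close>\<close>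
  | Add nat nat nat      \<comment> \<open>\<open>R[i] := R[j] + R[m]\<close>\<close>
  | Sub nat nat nat      \<comment> \<open>\<open>R[i] := R[j] - R[m]\<close>, truncated at 0\<close>
  | Load nat nat         \<comment> \<open>\<open>R[i] := M[R[j]]\<close>\<close>
  | Store nat nat        \<comment> \<open>\<open>M[R[i]] := R[j]\<close>\<close>
  | Jump nat
  | Jless nat nat nat    \<comment> \<open>jump to the third argument if \<open>R[i] < R[j]\<close>\<close>
  | Accept
  | Reject

type_synonym program = "instr list"

type_synonym config = "nat \<times> (nat \<Rightarrow> nat) \<times> (nat \<Rightarrow> nat)" \<comment> \<open>program counter, \<open>R\<close>, \<open>M\<close>\<close>

definition num_words :: "nat \<Rightarrow> nat \<Rightarrow> nat" where
  "num_words b x = max 1 (floorlog (2 ^ b) x)"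

text \<open>The lengths of numbers are known, so that a comparison need not read more
  words than the shorter of the two numbers has.\<close>

fun instr_cost :: "nat \<Rightarrow> instr \<Rightarrow> (nat \<Rightarrow> nat) \<Rightarrow> (nat \<Rightarrow> nat) \<Rightarrow> nat" where
  "instr_cost b (Const i c) R M = num_words b c"
| "instr_cost b (Add i j m) R M = num_words b (R j) + num_words b (R m)"
| "instr_cost b (Sub i j m) R M = num_words b (R j) + num_words b (R m)"
| "instr_cost b (Load i j) R M = num_words b (R j) + num_words b (M (R j))"
| "instr_cost b (Store i j) R M = num_words b (R i) + num_words b (R j)"
| "instr_cost b (Jless i j pc') R M = min (num_words b (R i)) (num_words b (R j))"
| "instr_cost b (Jump pc') R M = 1"
| "instr_cost b Accept R M = 1"
| "instr_cost b Reject R M = 1"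

fun instr_step :: "instr \<Rightarrow> config \<Rightarrow> config" where
  "instr_step (Const i c) (pc, R, M) = (pc + 1, R(i := c), M)"
| "instr_step (Add i j m) (pc, R, M) = (pc + 1, R(i := R j + R m), M)"
| "instr_step (Sub i j m) (pc, R, M) = (pc + 1, R(i := R j - R m), M)"
| "instr_step (Load i j) (pc, R, M) = (pc + 1, R(i := M (R j)), M)"
| "instr_step (Store i j) (pc, R, M) = (pc + 1, R, M(R i := R j))"
| "instr_step (Jump pc') (pc, R, M) = (pc', R, M)"
| "instr_step (Jless i j pc') (pc, R, M) = ((if R i < R j then pc' else pc + 1), R, M)"
| "instr_step Accept s = s"
| "instr_step Reject s = s"

text \<open>\<open>runs b P s ans T\<close>: started in configuration \<open>s\<close>, program \<open>P\<close> halts with answer \<open>ans\<close> after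
  time \<open>T\<close>, for word length \<open>b\<close>. A run that never halts or leaves the program has no answer.\<close>

inductive runs :: "nat \<Rightarrow> program \<Rightarrow> config \<Rightarrow> bool \<Rightarrow> nat \<Rightarrow> bool" for b P where
  accept: "pc < length P \<Longrightarrow> P ! pc = Accept \<Longrightarrow>
     runs b P (pc, R, M) True (instr_cost b (P ! pc) R M)"
| reject: "pc < length P \<Longrightarrow> P ! pc = Reject \<Longrightarrow>
     runs b P (pc, R, M) False (instr_cost b (P ! pc) R M)"
| step: "pc < length P \<Longrightarrow> P ! pc \<noteq> Accept \<Longrightarrow> P ! pc \<noteq> Reject \<Longrightarrow>
     runs b P (instr_step (P ! pc) (pc, R, M)) ans T \<Longrightarrow>
     runs b P (pc, R, M) ans (instr_cost b (P ! pc) R M + T)"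

lemma runs_deterministic:
  assumes "runs b P s ans T" and "runs b P s ans' T'"
  shows "ans = ans' \<and> T = T'"
  using assms
proof (induction arbitrary: ans' T' rule: runs.induct)
  case (accept pc R M)
  from accept(3) show ?case by (cases rule: runs.cases) (use accept(1,2) in simp_all)
next
  case (reject pc R M)
  from reject(3) show ?case by (cases rule: runs.cases) (use reject(1,2) in simp_all)
next
  case (step pc R M ans T)
  from step.prems show ?case
  proof (cases rule: runs.cases)
    case accept
    with step.hyps(2) show ?thesis by blast
  next
    case reject
    with step.hyps(3) show ?thesis by blast
  next
    case (step T'')
    from step.IH[OF step(5)] step(1) show ?thesis by blast
  qed
qed


section \<open>Instances as machine inputs\<close>

text \<open>The vertices are listed in increasing order, and the arcs are given as \<open>lifetime G\<close>
  consecutive weighted adjacency matrices, in row-major order, with entry \<open>0\<close> for a non-arc.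
  This list is stored in memory from address 0 on, and the numbers
  \<open>n\<close>, \<open>\<tau>\<close>, \<open>k\<close>, \<open>l\<close>, \<open>\<alpha>\<close> in the first registers.\<close>

definition weight_list :: "nat tgraph \<Rightarrow> nat list" where
  "weight_list G =
     [if (u, v) \<in> arcs G t then weight G t (u, v) else 0.
        t \<leftarrow> [1..<lifetime G + 1],
        u \<leftarrow> sorted_list_of_set (verts G), v \<leftarrow> sorted_list_of_set (verts G)]"

definition cells :: "nat list \<Rightarrow> nat \<Rightarrow> nat" where
  "cells xs i = (if i < length xs then xs ! i else 0)"

definition initial_config :: "nat tgraph \<Rightarrow> nat \<Rightarrow> nat \<Rightarrow> nat \<Rightarrow> config" where
  "initial_config G k l \<alpha> =
     (0, cells [card (verts G), lifetime G, k, l, \<alpha>], cells (weight_list G))"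

definition input_length :: "nat tgraph \<Rightarrow> nat" where
  "input_length G = 5 + length (weight_list G)"

end

theory Submission
  imports Defs
begin

text \<open>
  Only the order of the ranks and the times of their changes matter, so at most \<open>L = min l \<tau> + 1\<close>
  stages per vertex and \<open>K = min k (n L)\<close> ranks are needed: closing the gaps between the ranks in
  use does not increase any penalty. At each time step a configuration is then one of
  \<open>(K L)^n = (l n)^O(n)\<close> states, recording the current rank and stage of every vertex, and one step
  of dynamic programming computes the cheapest way to reach each state from the states of the
  previous time step. The inputs \<open>k\<close>, \<open>l\<close>, \<open>\<alpha>\<close> may be huge, but they are only compared with numbers that
  the program has computed, and these are at most \<open>2 (2^b) W Z\<close> with \<open>Z = (4 n l^2)^n\<close>. So an
  instruction reads \<open>O(Z log W)\<close> words, and \<open>O(\<tau> Z^4)\<close> instructions suffice.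
\<close>

section \<open>Structured programs\<close>

text \<open>The time bound must hold for every word length. Cost is therefore counted in units
  \<open>u\<close> that pay for any operand up to a bound \<open>B\<close>; the factor
  \<open>2 ^ b\<close> of \<open>B\<close> covers all input addresses and adds only a single word to
  the length of a number, whatever \<open>b\<close> is. A comparison costs as much as its shorter
  operand, so guards need a bound on one side only. The numbers \<open>k\<close> and
  \<open>l\<close> are copied only in branches where they have turned out smaller than a computed
  number, and \<alpha> is never copied at all. Without division and multiplication, digits of states
  are extracted by repeated subtraction, and weights are multiplied by penalties through repeated
  addition with the penalty as the count, so that weights influence the time only through their
  length. The losses are powers of \<open>Z\<close>, which the constant in the exponent absorbs;
  hence all bounds are stated coarsely in \<open>Z\<close>. Minimisation is reasoned about through
  thresholds: an entry is at most \<open>a\<close> iff some path of states costs at most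
  \<open>a\<close>. Staying in a state is always allowed, so no infinite value is needed.\<close>

datatype com =
    Skip
  | Op instr
  | Seq com com (infixr ";;" 60)
  | If nat nat com com
  | While nat nat com

fun basic :: "instr \<Rightarrow> bool" where
  "basic (Const i c) = True"
| "basic (Add i j m) = True"
| "basic (Sub i j m) = True"
| "basic (Load i j) = True"
| "basic (Store i j) = True"
| "basic _ = False"

type_synonym store = "(nat \<Rightarrow> nat) \<times> (nat \<Rightarrow> nat)"

text \<open>The costs are those of the compiled code. The extra 1 in \<open>IfFalse\<close> is the
  jump over the other branch; in \<open>WhileTrue\<close> and \<open>WhileFalse\<close> it is the
  jump back and the jump out of the loop. The program counter 0 passed to \<open>instr_step\<close>
  is a dummy.\<close>

inductive exec :: "nat \<Rightarrow> com \<Rightarrow> store \<Rightarrow> nat \<Rightarrow> store \<Rightarrow> bool" for b where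
  Skip: "exec b Skip s 0 s"
| Op: "basic i \<Longrightarrow> exec b (Op i) (R, M) (instr_cost b i R M) (snd (instr_step i (0, R, M)))"
| Seq: "exec b c s m s' \<Longrightarrow> exec b d s' m' s'' \<Longrightarrow> exec b (c ;; d) s (m + m') s''"
| IfTrue: "R i < R j \<Longrightarrow> exec b c (R, M) m s \<Longrightarrow>
    exec b (If i j c d) (R, M) (min (num_words b (R i)) (num_words b (R j)) + m) s"
| IfFalse: "\<not> R i < R j \<Longrightarrow> exec b d (R, M) m s \<Longrightarrow>
    exec b (If i j c d) (R, M) (min (num_words b (R i)) (num_words b (R j)) + (m + 1)) s"
| WhileTrue: "R i < R j \<Longrightarrow> exec b c (R, M) m s \<Longrightarrow> exec b (While i j c) s m' s' \<Longrightarrow>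
    exec b (While i j c) (R, M) (min (num_words b (R i)) (num_words b (R j)) + (m + (1 + m'))) s'"
| WhileFalse: "\<not> R i < R j \<Longrightarrow>
    exec b (While i j c) (R, M) (min (num_words b (R i)) (num_words b (R j)) + 1) (R, M)"

fun code_size :: "com \<Rightarrow> nat" where
  "code_size Skip = 0"
| "code_size (Op i) = 1"
| "code_size (c ;; d) = code_size c + code_size d"
| "code_size (If i j c d) = code_size c + code_size d + 2"
| "code_size (While i j c) = code_size c + 3"

text \<open>Jump targets are absolute, hence the argument \<open>pc\<close>. \<open>Jless\<close>
  branches when the guard holds, so the else branch comes first in the code, and a loop starts by
  skipping over its own exit jump.\<close>

fun compile :: "nat \<Rightarrow> com \<Rightarrow> program" where
  "compile pc Skip = []"
| "compile pc (Op i) = [i]"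
| "compile pc (c ;; d) = compile pc c @ compile (pc + code_size c) d"
| "compile pc (If i j c d) =
     Jless i j (pc + code_size d + 2) # compile (pc + 1) d @
     Jump (pc + code_size d + 2 + code_size c) # compile (pc + code_size d + 2) c"
| "compile pc (While i j c) =
     Jless i j (pc + 2) # Jump (pc + code_size c + 3) # compile (pc + 2) c @ [Jump pc]"

lemma length_compile [simp]: "length (compile pc c) = code_size c"
  by (induction c arbitrary: pc) auto

fun code_at :: "program \<Rightarrow> nat \<Rightarrow> program \<Rightarrow> bool" where
  "code_at P pc [] = True"
| "code_at P pc (i # is) = (pc < length P \<and> P ! pc = i \<and> code_at P (Suc pc) is)"

lemma code_at_append [simp]:
  "code_at P pc (xs @ ys) \<longleftrightarrow> code_at P pc xs \<and> code_at P (pc + length xs) ys"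
  by (induction xs arbitrary: pc) auto

lemma code_at_prefix: "code_at (ys @ xs @ zs) (length ys) xs"
proof (induction xs arbitrary: ys)
  case (Cons x xs)
  show ?case using Cons[of "ys @ [x]"] by (simp add: nth_append)
qed simp

lemma runs_basic:
  assumes "pc < length P" "P ! pc = i" "basic i"
    and "runs b P (Suc pc, snd (instr_step i (0, R, M))) ans T"
  shows "runs b P (pc, R, M) ans (instr_cost b i R M + T)"
proof -
  have "instr_step i (pc, R, M) = (Suc pc, snd (instr_step i (0, R, M)))"
    using assms(3) by (cases i) auto
  then show ?thesis
    using runs.step[of pc P b R M ans T] assms by (cases i) auto
qed

lemma runs_Jump:
  assumes "pc < length P" "P ! pc = Jump pc'" "runs b P (pc', s) ans T"
  shows "runs b P (pc, s) ans (1 + T)"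
  using runs.step[of pc P b "fst s" "snd s" ans T] assms by (cases s) simp

lemma runs_Jless:
  assumes "pc < length P" "P ! pc = Jless i j pc'"
    and "runs b P (if R i < R j then pc' else Suc pc, R, M) ans T"
  shows "runs b P (pc, R, M) ans (min (num_words b (R i)) (num_words b (R j)) + T)"
  using runs.step[of pc P b R M ans T] assms by (simp split: if_splits)

text \<open>\<open>runs\<close> speaks of complete runs up to the answer only. Correctness is
  therefore stated backwards: a run from the end of the code extends to a run from its beginning,
  and the times add up.\<close>

lemma compile_correct:
  assumes "exec b c s m s'" "code_at P pc (compile pc c)"
    and "runs b P (pc + code_size c, s') ans T"
  shows "runs b P (pc, s) ans (m + T)"
  using assms
proof (induction arbitrary: pc T rule: exec.induct)
  case (Skip s)
  then show ?case by simp
next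
  case (Op i R M)
  then show ?case by (auto intro: runs_basic)
next
  case (Seq c s m s' d m' s'')
  have "runs b P (pc + code_size c, s') ans (m' + T)"
    using Seq.prems by (intro Seq.IH(2)) (auto simp: add.assoc)
  then show ?case
    using Seq.IH(1)[of pc "m' + T"] Seq.prems by (simp add: add.assoc)
next
  case (IfTrue R i j c M m s d)
  have "runs b P (pc + code_size d + 2, R, M) ans (m + T)"
    using IfTrue.prems by (intro IfTrue.IH) (auto simp: algebra_simps)
  then show ?case
    using runs_Jless[of pc P i j "pc + code_size d + 2" b R M ans "m + T"] IfTrue
    by (simp add: add.assoc)
next
  case (IfFalse R i j d M m s c)
  have "runs b P (Suc pc + code_size d, s) ans (1 + T)"
    using IfFalse.prems by (intro runs_Jump[where pc' = "pc + code_size d + 2 + code_size c"])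
      (auto simp: algebra_simps)
  then have "runs b P (Suc pc, R, M) ans (m + (1 + T))"
    using IfFalse.prems by (intro IfFalse.IH) auto
  then show ?case
    using runs_Jless[of pc P i j "pc + code_size d + 2" b R M ans "m + (1 + T)"] IfFalse
    by (simp add: add.assoc)
next
  case (WhileTrue R i j c M m s m' s')
  have "runs b P (pc, s) ans (m' + T)"
    using WhileTrue.prems by (intro WhileTrue.IH(2))
  then have "runs b P (pc + 2 + code_size c, s) ans (1 + (m' + T))"
    using WhileTrue.prems by (intro runs_Jump[where pc' = pc]) auto
  then have "runs b P (pc + 2, R, M) ans (m + (1 + (m' + T)))"
    using WhileTrue.prems by (intro WhileTrue.IH(1)) auto
  then show ?case
    using runs_Jless[of pc P i j "pc + 2" b R M ans "m + (1 + (m' + T))"] WhileTrue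
    by (simp add: add.assoc)
next
  case (WhileFalse R i j c M)
  have "runs b P (Suc pc, R, M) ans (1 + T)"
    using WhileFalse.prems by (intro runs_Jump[where pc' = "pc + code_size c + 3"])
      (auto simp: algebra_simps)
  then show ?case
    using runs_Jless[of pc P i j "pc + 2" b R M ans "1 + T"] WhileFalse
    by (simp add: add.assoc)
qed

definition decision_program :: "com \<Rightarrow> nat \<Rightarrow> nat \<Rightarrow> program" where
  "decision_program c i j = compile 0 c @ [Jless i j (code_size c + 2), Reject, Accept]"

text \<open>The 2 consists of the final comparison, which reads one word because its left operand is
  0, and the halting instruction.\<close>

lemma runs_decision_program:
  assumes "exec b c (R, M) m (R', M')" and "R' i = 0"
  shows "runs b (decision_program c i j) (0, R, M) (0 < R' j) (m + 2)"
proof -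
  let ?P = "decision_program c i j" and ?k = "code_size c"
  have len: "length ?P = ?k + 3" and nth: "?P ! ?k = Jless i j (?k + 2)"
    "?P ! (?k + 1) = Reject" "?P ! (?k + 2) = Accept"
    by (auto simp: decision_program_def nth_append)
  have "runs b ?P (if R' i < R' j then ?k + 2 else Suc ?k, R', M') (0 < R' j) 1"
    using runs.accept[of "?k + 2" ?P b R' M'] runs.reject[of "?k + 1" ?P b R' M'] len nth assms
    by auto
  from runs_Jless[OF _ nth(1) this] len assms
  have "runs b ?P (?k, R', M') (0 < R' j) 2"
    by (simp add: num_words_def floorlog_def numeral_2_eq_2)
  then show ?thesis
    using compile_correct[OF assms(1), of ?P 0 "0 < R' j" 2] code_at_prefix[of "[]" "compile 0 c"]
    by (simp add: decision_program_def)
qed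


section \<open>Total correctness with time bounds\<close>

text \<open>Time is counted in units of \<open>u\<close>, which pays for any instruction with operands up to \<open>B\<close>.\<close>

locale machine =
  fixes b B u :: nat
  assumes unit: "x \<le> B \<Longrightarrow> 2 * num_words b x + 1 \<le> u"
begin

text \<open>A derivation of \<open>exec\<close> is finite, so its existence includes termination.
  Keeping the time as a multiple of \<open>u\<close> frees all later bounds from word
  lengths.\<close>

definition wp :: "com \<Rightarrow> store \<Rightarrow> nat \<Rightarrow> (store \<Rightarrow> bool) \<Rightarrow> bool" where
  "wp c s N Q \<longleftrightarrow> (\<exists>m s'. exec b c s m s' \<and> m \<le> u * N \<and> Q s')"

lemma wp_mono:
  assumes "wp c s N Q" "\<And>s. Q s \<Longrightarrow> Q' s" "N \<le> N'"
  shows "wp c s N' Q'"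
  using assms mult_le_mono2[OF assms(3), of u] unfolding wp_def by (meson order_trans)

lemma wp_time: "wp c s N Q \<Longrightarrow> N \<le> N' \<Longrightarrow> wp c s N' Q"
  by (rule wp_mono)

lemma wp_Skip: "Q s \<Longrightarrow> wp Skip s 0 Q"
  unfolding wp_def by (intro exI[of _ 0] exI[of _ s]) (simp add: exec.Skip)

lemma wp_basic:
  assumes "basic i" "instr_cost b i R M \<le> u" "Q (snd (instr_step i (0, R, M)))"
  shows "wp (Op i) (R, M) 1 Q"
  unfolding wp_def using exec.Op[of i b R M] assms by (intro exI conjI) auto

lemma wp_Const: "c \<le> B \<Longrightarrow> Q (R(i := c), M) \<Longrightarrow> wp (Op (Const i c)) (R, M) 1 Q"
  using unit[of c] by (intro wp_basic) auto

lemma wp_Add: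
  "R j \<le> B \<Longrightarrow> R m \<le> B \<Longrightarrow> Q (R(i := R j + R m), M) \<Longrightarrow> wp (Op (Add i j m)) (R, M) 1 Q"
  using unit[of "R j"] unit[of "R m"] by (intro wp_basic) auto

lemma wp_Sub:
  "R j \<le> B \<Longrightarrow> R m \<le> B \<Longrightarrow> Q (R(i := R j - R m), M) \<Longrightarrow> wp (Op (Sub i j m)) (R, M) 1 Q"
  using unit[of "R j"] unit[of "R m"] by (intro wp_basic) auto

lemma wp_Load:
  "R j \<le> B \<Longrightarrow> M (R j) \<le> B \<Longrightarrow> Q (R(i := M (R j)), M) \<Longrightarrow> wp (Op (Load i j)) (R, M) 1 Q"
  using unit[of "R j"] unit[of "M (R j)"] by (intro wp_basic) auto

lemma wp_Store:
  "R i \<le> B \<Longrightarrow> R j \<le> B \<Longrightarrow> Q (R, M(R i := R j)) \<Longrightarrow> wp (Op (Store i j)) (R, M) 1 Q"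
  using unit[of "R i"] unit[of "R j"] by (intro wp_basic) auto

lemma wp_Seq: "wp c s N (\<lambda>s'. wp d s' N' Q) \<Longrightarrow> wp (c ;; d) s (N + N') Q"
  unfolding wp_def distrib_left by (meson exec.Seq add_mono)

text \<open>A bound on one operand suffices, since the comparison is charged the shorter length.
  This is what permits guards that involve the unbounded inputs.\<close>

lemma wp_IfTrue:
  assumes "R i < R j" "R i \<le> B \<or> R j \<le> B" "wp c (R, M) N Q"
  shows "wp (If i j c d) (R, M) (1 + N) Q"
proof -
  have w: "min (num_words b (R i)) (num_words b (R j)) + 1 \<le> u"
    using assms(2) unit[of "R i"] unit[of "R j"] by auto
  from assms(3) obtain m s where "exec b c (R, M) m s" "m \<le> u * N" "Q s"
    unfolding wp_def by blast
  with exec.IfTrue[of R i j b c M m s d] assms(1) w show ?thesis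
    unfolding wp_def distrib_left by (intro exI conjI) auto
qed

lemma wp_IfFalse:
  assumes "\<not> R i < R j" "R i \<le> B \<or> R j \<le> B" "wp d (R, M) N Q"
  shows "wp (If i j c d) (R, M) (1 + N) Q"
proof -
  have w: "min (num_words b (R i)) (num_words b (R j)) + 1 \<le> u"
    using assms(2) unit[of "R i"] unit[of "R j"] by auto
  from assms(3) obtain m s where "exec b d (R, M) m s" "m \<le> u * N" "Q s"
    unfolding wp_def by blast
  with exec.IfFalse[of R i j b d M m s c] assms(1) w show ?thesis
    unfolding wp_def distrib_left by (intro exI conjI) auto
qed

text \<open>The sum of both branch bounds replaces their maximum; the branches treated this way take
  constant time, so little is lost.\<close>

lemma wp_If:
  assumes "R i \<le> B \<or> R j \<le> B"
    and "R i < R j \<Longrightarrow> wp c (R, M) N Q"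
    and "\<not> R i < R j \<Longrightarrow> wp d (R, M) N' Q"
  shows "wp (If i j c d) (R, M) (1 + N + N') Q"
proof (cases "R i < R j")
  case True
  then show ?thesis by (intro wp_time[OF wp_IfTrue]) (use assms in auto)
next
  case False
  then show ?thesis by (intro wp_time[OF wp_IfFalse]) (use assms in auto)
qed

text \<open>The number \<open>m\<close> of iterations is fixed in advance and indexes the invariant,
  so no separate variant is needed. One unit per iteration pays for the guard and the jump back
  together.\<close>

lemma wp_While:
  assumes "I 0 R M"
    and "\<And>x R M. x < m \<Longrightarrow> I x R M \<Longrightarrow>
      R i < R j \<and> R j \<le> B \<and> wp c (R, M) N (\<lambda>(R, M). I (Suc x) R M)"
    and "\<And>R M. I m R M \<Longrightarrow> \<not> R i < R j \<and> R j \<le> B \<and> Q (R, M)"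
  shows "wp (While i j c) (R, M) (m * (1 + N) + 1) Q"
proof -
  have "wp (While i j c) (R, M) (d * (1 + N) + 1) Q"
    if "x \<le> m" "d = m - x" "I x R M" for x d R M
    using that
  proof (induction d arbitrary: x R M)
    case 0
    then have "I m R M" by simp
    from assms(3)[OF this] have "\<not> R i < R j" "R j \<le> B" "Q (R, M)" by auto
    with exec.WhileFalse[of R i j b c M] unit[of "R j"] show ?case
      unfolding wp_def by (intro exI conjI) (assumption | simp)+
  next
    case (Suc d)
    then have "x < m" by simp
    from assms(2)[OF this Suc.prems(3)]
    obtain k R' M' where less: "R i < R j" and w: "2 * num_words b (R j) + 1 \<le> u"
      and k: "exec b c (R, M) k (R', M')" "k \<le> u * N" and I: "I (Suc x) R' M'"
      unfolding wp_def using unit[of "R j"] by auto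
    have "wp (While i j c) (R', M') (d * (1 + N) + 1) Q"
      using Suc.prems by (intro Suc.IH[OF _ _ I]) auto
    then obtain k' s
      where "exec b (While i j c) (R', M') k' s" "k' \<le> u * (d * (1 + N) + 1)" "Q s"
      unfolding wp_def by auto
    with exec.WhileTrue[OF less k(1) this(1)] w k(2) show ?case
      unfolding wp_def by (intro exI conjI) (assumption | simp add: min_le_iff_disj algebra_simps)+
  qed
  from this[of 0 m R M] assms(1) show ?thesis by simp
qed

end

subsection \<open>Arithmetic macros\<close>

text \<open>Registers 5 and 6 hold the constants 0 and 1 throughout.\<close>

definition divmod :: "nat \<Rightarrow> nat \<Rightarrow> nat \<Rightarrow> com" where
  "divmod i j m =
     Op (Add m i 6) ;; Op (Const i 0) ;;
     While j m (Op (Sub m m j) ;; Op (Add i i 6)) ;;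
     Op (Sub m m 6)"

definition muladd :: "nat \<Rightarrow> nat \<Rightarrow> nat \<Rightarrow> nat \<Rightarrow> com" where
  "muladd i j m c = Op (Const c 0) ;; While c m (Op (Add i i j) ;; Op (Add c c 6))"

context machine
begin

text \<open>Repeated subtraction starts from \<open>x + 1\<close>, because the strict guard
  \<open>y < x + 1 - q * y\<close> then says that \<open>y\<close> can be subtracted once more; the
  last instruction removes the extra 1. The parameter \<open>T\<close> makes the time independent of
  \<open>x\<close>.\<close>

lemma wp_divmod:
  assumes "R i = x" "R j = y" and "R 6 = 1" "0 < y" "x \<le> T" "T + 1 \<le> B" "y \<le> B"
    and "distinct [i, j, m, 6]" and Q: "Q (R(i := x div y, m := x mod y), M)"
  shows "wp (divmod i j m) (R, M) (3 * T + 4) Q"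
proof -
  have d: "i \<noteq> j" "i \<noteq> m" "i \<noteq> 6" "j \<noteq> m" "j \<noteq> 6" "m \<noteq> 6" "m \<noteq> i" "j \<noteq> i"
    using assms(8) by auto
  have le: "q * y \<le> x" if "q \<le> x div y" for q
    using that assms(4) by (simp add: less_eq_div_iff_mult_less_eq)
  have div_le: "x div y \<le> T" using assms(5) div_le_dividend order_trans by blast
  let ?I = "\<lambda>q R' M'. R' i = q \<and> R' m = x + 1 - q * y \<and> (\<forall>k. k \<noteq> i \<longrightarrow> k \<noteq> m \<longrightarrow> R' k = R k) \<and> M' = M"
  let ?loop = "While j m (Op (Sub m m j) ;; Op (Add i i 6))"
  have sub: "wp (Op (Sub m m 6)) (R', M') 1 Q" if I: "?I (x div y) R' M'" for R' M'
  proof -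
    have eq: "x + 1 - x div y * y - 1 = x mod y"
      using le[of "x div y"] by (simp add: minus_div_mult_eq_mod)
    have le_B: "x + 1 - x div y * y \<le> B" "1 \<le> B" using assms(5,6) by auto
    have "R'(m := x mod y) = R(i := x div y, m := x mod y)"
      using [[linarith_neq_limit = 0]] I d by (intro ext) auto
    then show ?thesis using [[linarith_neq_limit = 0]] I d assms(3) eq Q le_B by (intro wp_Sub) simp_all
  qed
  have loop: "wp ?loop (R', M') (x div y * (1 + (1 + 1)) + 1) (\<lambda>s. wp (Op (Sub m m 6)) s 1 Q)"
    if "?I 0 R' M'" for R' M'
  proof (rule wp_While[where I = ?I])
    fix q R' M' assume q: "q < x div y" and I: "?I q R' M'"
    have *: "y + q * y \<le> x" using le[of "Suc q"] q by simp
    have R': "R' i = q" "R' m = x + 1 - q * y" "R' j = y" "R' 6 = 1" "M' = M"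
      using [[linarith_neq_limit = 0]] I d assms(2,3) by simp_all
    have le_B: "x + 1 - q * y \<le> B" "y \<le> B" "q \<le> B" "1 \<le> B"
      using assms(5-7) q div_le by auto
    have "wp (Op (Sub m m j) ;; Op (Add i i 6)) (R', M') (1 + 1) (\<lambda>(R', M'). ?I (Suc q) R' M')"
      using [[linarith_neq_limit = 0]] I d R' le_B by (intro wp_Seq wp_Sub wp_Add) (simp_all add: add.commute)
    then show "R' j < R' m \<and> R' m \<le> B \<and>
        wp (Op (Sub m m j) ;; Op (Add i i 6)) (R', M') (1 + 1) (\<lambda>(R', M'). ?I (Suc q) R' M')"
      using R' * assms(5,6) by (auto simp: less_diff_conv)
  next
    fix R' M' assume I: "?I (x div y) R' M'"
    have "x + 1 - x div y * y \<le> y"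
      using assms(4) by (simp add: minus_div_mult_eq_mod Suc_diff_le Suc_leI)
    moreover have "R' j = y" "R' m = x + 1 - x div y * y"
      using [[linarith_neq_limit = 0]] I d assms(2) by simp_all
    ultimately show "\<not> R' j < R' m \<and> R' m \<le> B \<and> wp (Op (Sub m m 6)) (R', M') 1 Q"
      using sub[OF I] assms(7) by simp
  qed (rule that)
  have "wp (divmod i j m) (R, M) (1 + (1 + ((x div y * (1 + (1 + 1)) + 1) + 1))) Q"
    unfolding divmod_def
    using assms(1-7) d by (intro wp_Seq wp_Add wp_Const loop) simp_all
  then show ?thesis by (rule wp_mono) (use div_le in auto)
qed

text \<open>The time is linear in the multiplier \<open>y\<close> alone. A factor that may be large,
  such as a weight, therefore has to be the addend \<open>x\<close>.\<close>

lemma wp_muladd: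
  assumes "R i = a" "R j = x" "R m = y" and "R 6 = 1" "a + x * y \<le> B" "x \<le> B" "y \<le> B" "1 \<le> B"
    and "distinct [i, j, c, 6]" "distinct [i, m, c, 6]" and Q: "Q (R(i := a + x * y, c := y), M)"
  shows "wp (muladd i j m c) (R, M) (3 * y + 2) Q"
proof -
  have d: "i \<noteq> j" "i \<noteq> m" "i \<noteq> c" "j \<noteq> c" "m \<noteq> c" "i \<noteq> 6" "c \<noteq> 6" "j \<noteq> i" "m \<noteq> i" "c \<noteq> i"
    using assms(9,10) by auto
  have le: "a + x * q \<le> B" if "q \<le> y" for q
    using mult_le_mono2[OF that, of x] assms(5) by linarith
  let ?I = "\<lambda>q R' M'. R' i = a + x * q \<and> R' c = q \<and> (\<forall>k. k \<noteq> i \<longrightarrow> k \<noteq> c \<longrightarrow> R' k = R k) \<and> M' = M"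
  have loop: "wp (While c m (Op (Add i i j) ;; Op (Add c c 6))) (R', M') (y * (1 + (1 + 1)) + 1) Q"
    if "?I 0 R' M'" for R' M'
  proof (rule wp_While[where I = ?I])
    fix q R' M' assume q: "q < y" and I: "?I q R' M'"
    have R': "R' i = a + x * q" "R' c = q" "R' j = x" "R' m = y" "R' 6 = 1" "M' = M"
      using [[linarith_neq_limit = 0]] I d assms(2,3,4) by simp_all
    have le_B: "a + x * q \<le> B" "x \<le> B" "q \<le> B" "1 \<le> B"
      using assms(6-8) q le[of q] by auto
    have "wp (Op (Add i i j) ;; Op (Add c c 6)) (R', M') (1 + 1) (\<lambda>(R', M'). ?I (Suc q) R' M')"
      using [[linarith_neq_limit = 0]] I d R' le_B by (intro wp_Seq wp_Add) simp_all
    then show "R' c < R' m \<and> R' m \<le> B \<and>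
        wp (Op (Add i i j) ;; Op (Add c c 6)) (R', M') (1 + 1) (\<lambda>(R', M'). ?I (Suc q) R' M')"
      using R' q assms(7) by simp
  next
    fix R' M' assume I: "?I y R' M'"
    then have "R' = R(i := a + x * y, c := y)" using d by (intro ext) auto
    then show "\<not> R' c < R' m \<and> R' m \<le> B \<and> Q (R', M')"
      using I Q d assms(3,7) by simp
  qed (rule that)
  have "?I 0 (R(c := 0)) M" using assms(1) d by simp
  from loop[of "R(c := 0)" M, OF this] have "wp (muladd i j m c) (R, M) (1 + (y * (1 + (1 + 1)) + 1)) Q"
    unfolding muladd_def by (intro wp_Seq wp_Const) simp_all
  then show ?thesis by (rule wp_mono) auto
qed

end

section \<open>Normal form of rank segmentations\<close>

text \<open>A certificate for at most \<open>l\<close> rank changes without change points: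
  \<open>g\<close> numbers the stages, may skip some of them, and the rank is constant on each. The
  condition on \<open>s\<close> and \<open>t\<close> is transitive, so it can be checked between
  consecutive times.\<close>

definition stages :: "nat \<Rightarrow> nat \<Rightarrow> (nat \<Rightarrow> nat) \<Rightarrow> (nat \<Rightarrow> nat) \<Rightarrow> bool" where
  "stages \<tau> l r g \<longleftrightarrow> (\<forall>t\<in>{1..\<tau>}. g t \<le> l) \<and>
     (\<forall>s\<in>{1..\<tau>}. \<forall>t\<in>{s..\<tau>}. g s < g t \<or> g s = g t \<and> r s = r t)"

lemma stages_mono: "stages \<tau> l r g \<Longrightarrow> 1 \<le> s \<Longrightarrow> s \<le> t \<Longrightarrow> t \<le> \<tau> \<Longrightarrow> g s \<le> g t"
  unfolding stages_def by (metis atLeastAtMost_iff eq_imp_le nat_less_le order_trans)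

lemma stages_eq:
  assumes "stages \<tau> l r g" "s \<in> {1..\<tau>}" "t \<in> {1..\<tau>}" "g s = g t"
  shows "r s = r t"
proof (cases "s \<le> t")
  case True
  then have "t \<in> {s..\<tau>}" using assms by auto
  then show ?thesis using assms(1,2,4) unfolding stages_def by (metis less_irrefl)
next
  case False
  then have "s \<in> {t..\<tau>}" using assms by auto
  then show ?thesis using assms(1,3,4) unfolding stages_def by (metis less_irrefl)
qed

text \<open>The stage at time \<open>t\<close> is the largest index of a change point not after
  \<open>t\<close>, or 0 if there is none; it selects the clause of the segmentation that determines
  the rank.\<close>

lemma rank_segmentation_imp_stages:
  assumes "rank_segmentation V \<tau> k l r" "v \<in> V"
  shows "\<exists>g. stages \<tau> l (r v) g"
proof -
  from assms(1) obtain rs c where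
    first: "\<And>t. t \<in> {1..\<tau>} \<Longrightarrow> l = 0 \<or> t < c v 1 \<Longrightarrow> r v t = rs 0 v" and
    mid: "\<And>t i. t \<in> {1..\<tau>} \<Longrightarrow> i \<in> {1..<l} \<Longrightarrow> c v i \<le> t \<Longrightarrow> t < c v (i + 1) \<Longrightarrow> r v t = rs i v" and
    last: "\<And>t. t \<in> {1..\<tau>} \<Longrightarrow> 1 \<le> l \<Longrightarrow> c v l \<le> t \<Longrightarrow> r v t = rs l v"
    unfolding rank_segmentation_def using assms(2) by blast
  define A where "A t = {i \<in> {1..l}. c v i \<le> t}" for t
  define g where "g t = Max (insert 0 (A t))" for t
  have fin: "finite (A t)" for t by (simp add: A_def)
  have g_le: "g t \<le> l" for t
    using fin[of t] by (auto simp: g_def A_def)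
  have g_mono: "g s \<le> g t" if "s \<le> t" for s t
    unfolding g_def using fin that by (intro Max_mono) (auto simp: A_def)
  have rs: "r v t = rs (g t) v" if t: "t \<in> {1..\<tau>}" for t
  proof -
    have ge: "c v (g t) \<le> t" if "g t \<noteq> 0"
      using Max_in[of "insert 0 (A t)"] fin that by (auto simp: g_def A_def)
    have lt: "t < c v (g t + 1)" if "g t < l"
    proof (rule ccontr)
      assume "\<not> t < c v (g t + 1)"
      then have "g t + 1 \<in> A t" using that by (auto simp: A_def)
      then have "g t + 1 \<le> g t" using fin[of t] unfolding g_def by (intro Max_ge) auto
      then show False by simp
    qed
    show ?thesis
    proof (cases "g t = 0")
      case True
      then show ?thesis using first[OF t] lt by (cases "l = 0") auto
    next
      case False
      then show ?thesis
        using mid[OF t, of "g t"] last[OF t] ge lt g_le[of t] by (cases "g t = l") auto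
    qed
  qed
  have "stages \<tau> l (r v) g"
    unfolding stages_def
  proof (intro conjI ballI)
    fix s t assume "s \<in> {1..\<tau>}" "t \<in> {s..\<tau>}"
    then show "g s < g t \<or> g s = g t \<and> r v s = r v t"
      using g_mono[of s t] rs[of s] rs[of t] by (auto simp: nat_less_le)
  qed (rule g_le)
  then show ?thesis by blast
qed

text \<open>The \<open>i\<close>-th change point is the first time at which stage \<open>i\<close>
  or a later one is reached, and the rank of a stage is read off at any time spent in it.\<close>

lemma stages_imp_rank_segmentation:
  assumes "1 \<le> \<tau>" "1 \<le> k" and r: "\<And>v t. v \<in> V \<Longrightarrow> t \<in> {1..\<tau>} \<Longrightarrow> r v t \<in> {1..k}"
    and "\<And>v. v \<in> V \<Longrightarrow> \<exists>g. stages \<tau> l (r v) g"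
  shows "rank_segmentation V \<tau> k l r"
proof -
  from assms(4) obtain g where g: "\<And>v. v \<in> V \<Longrightarrow> stages \<tau> l (r v) (g v)"
    by metis
  txt \<open>Every change point has to exist, so the unused stages are squeezed into the last time step.\<close>
  define h where "h v t = (if t = \<tau> then l else g v t)" for v t
  have h: "stages \<tau> l (r v) (h v)" if "v \<in> V" for v
    unfolding stages_def
  proof (intro conjI ballI)
    fix s t assume st: "s \<in> {1..\<tau>}" "t \<in> {s..\<tau>}"
    have "g v s \<le> g v t" "g v t \<le> l" "g v s = g v t \<Longrightarrow> r v s = r v t"
      using g[OF that] st stages_mono[OF g[OF that], of s t] stages_eq[OF g[OF that], of s t]
      by (auto simp: stages_def)
    \<comment> \<open>The modified last stage merges with an earlier one only if
      \<open>g v s = l\<close>. Then monotonicity forces \<open>g v \<tau> = l\<close> as well, and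
      the ranks agree.\<close>
    then show "h v s < h v t \<or> h v s = h v t \<and> r v s = r v t"
      using st by (auto simp: h_def)
  qed (use g[OF that] in \<open>auto simp: h_def stages_def\<close>)
  define c where "c v i = (LEAST t. 1 \<le> t \<and> i \<le> h v t)" for v i
  \<comment> \<open>A stage that never occurs gets rank 1, which only has to lie in
    \<open>{1..k}\<close>.\<close>
  define rs where "rs i v = (if \<exists>t\<in>{1..\<tau>}. h v t = i
    then r v (SOME t. t \<in> {1..\<tau>} \<and> h v t = i) else 1)" for i v
  have c_le_iff: "c v i \<le> t \<longleftrightarrow> i \<le> h v t" if "v \<in> V" "i \<in> {1..l}" "t \<in> {1..\<tau>}" for v i t
  proof
    have *: "1 \<le> c v i \<and> i \<le> h v (c v i)"
      unfolding c_def by (rule LeastI[of _ \<tau>]) (use assms(1) that(2) in \<open>simp add: h_def\<close>)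
    show "i \<le> h v t" if "c v i \<le> t"
      using stages_mono[OF h[OF \<open>v \<in> V\<close>], of "c v i" t] * that \<open>t \<in> {1..\<tau>}\<close> by auto
    show "c v i \<le> t" if "i \<le> h v t"
      unfolding c_def using that \<open>t \<in> {1..\<tau>}\<close> by (intro Least_le) auto
  qed
  have c_range: "c v i \<in> {1..\<tau>}" if "v \<in> V" "i \<in> {1..l}" for v i
  proof -
    have "1 \<le> c v i \<and> i \<le> h v (c v i)"
      unfolding c_def by (rule LeastI[of _ \<tau>]) (use assms(1) that(2) in \<open>simp add: h_def\<close>)
    then show ?thesis using c_le_iff[OF that, of \<tau>] assms(1) that(2) by (auto simp: h_def)
  qed
  have rs_eq: "r v t = rs (h v t) v" if "v \<in> V" "t \<in> {1..\<tau>}" for v t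
  proof -
    let ?s = "SOME s. s \<in> {1..\<tau>} \<and> h v s = h v t"
    have "?s \<in> {1..\<tau>} \<and> h v ?s = h v t"
      by (rule someI[of _ t]) (use that in auto)
    then have "r v ?s = r v t" using stages_eq[OF h[OF that(1)], of ?s t] that by auto
    then show ?thesis using that unfolding rs_def by auto
  qed
  have h_le: "h v t \<le> l" if "v \<in> V" "t \<in> {1..\<tau>}" for v t
    using h[OF that(1)] that(2) by (auto simp: stages_def)
  have rs_range: "rs i v \<in> {1..k}" if "v \<in> V" for i v
  proof (cases "\<exists>t\<in>{1..\<tau>}. h v t = i")
    case True
    then obtain t where "t \<in> {1..\<tau>}" "h v t = i" by blast
    then show ?thesis using rs_eq[OF that, of t] r[OF that, of t] by simp
  next
    case False
    then show ?thesis using assms(2) unfolding rs_def by auto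
  qed
  have "c v i \<le> c v (i + 1)" if "v \<in> V" "i \<in> {1..<l}" for v i
  proof -
    have "i + 1 \<in> {1..l}" "i \<in> {1..l}" using that(2) by auto
    then show ?thesis
      using c_le_iff[OF that(1), of "i + 1" "c v (i + 1)"] c_le_iff[OF that(1), of i "c v (i + 1)"]
        c_range[OF that(1), of "i + 1"] by simp
  qed
  moreover have "(l = 0 \<or> t < c v 1 \<longrightarrow> r v t = rs 0 v) \<and>
      (\<forall>i\<in>{1..<l}. c v i \<le> t \<and> t < c v (i + 1) \<longrightarrow> r v t = rs i v) \<and>
      (1 \<le> l \<and> c v l \<le> t \<longrightarrow> r v t = rs l v)" if "v \<in> V" "t \<in> {1..\<tau>}" for v t
  proof (intro conjI ballI impI)
    assume *: "l = 0 \<or> t < c v 1"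
    have "h v t = 0"
    proof (cases "l = 0")
      case True
      then show ?thesis using h_le[OF that] by simp
    next
      case False
      then show ?thesis using * c_le_iff[OF that(1) _ that(2), of 1] by auto
    qed
    then show "r v t = rs 0 v" using rs_eq[OF that] by simp
  next
    fix i assume "i \<in> {1..<l}" "c v i \<le> t \<and> t < c v (i + 1)"
    then have "h v t = i"
      using c_le_iff[OF that(1) _ that(2), of i] c_le_iff[OF that(1) _ that(2), of "i + 1"] by auto
    then show "r v t = rs i v" using rs_eq[OF that] by simp
  next
    assume "1 \<le> l \<and> c v l \<le> t"
    then have "h v t = l"
      using c_le_iff[OF that(1) _ that(2), of l] h_le[OF that] by auto
    then show "r v t = rs l v" using rs_eq[OF that] by simp
  qed
  ultimately show ?thesis
    unfolding rank_segmentation_def using r rs_range c_range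
    by (intro conjI exI[of _ rs] exI[of _ c]) blast+
qed

text \<open>Stages are renumbered by the count of distinct stages seen so far, minus one for the
  first. There are at most \<open>l + 1\<close> values, and at most \<open>t\<close> of them are
  seen by time \<open>t\<close>. As \<open>g\<close> is monotone, the count grows exactly when the
  stage changes.\<close>

lemma stages_clamp:
  assumes "stages \<tau> l r g"
  shows "\<exists>g. stages \<tau> (min l \<tau>) r g"
proof -
  define h where "h t = card (g ` {1..t}) - 1" for t
  have "stages \<tau> (min l \<tau>) r h"
    unfolding stages_def
  proof (intro conjI ballI)
    fix t assume t: "t \<in> {1..\<tau>}"
    have "card (g ` {1..t}) \<le> card {0..l}"
      using assms t by (intro card_mono) (auto simp: stages_def)
    moreover have "card (g ` {1..t}) \<le> t"
      using card_image_le[of "{1..t}" g] by simp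
    ultimately show "h t \<le> min l \<tau>" using t by (auto simp: h_def)
  next
    fix s t assume s: "s \<in> {1..\<tau>}" and t: "t \<in> {s..\<tau>}"
    have le: "g x \<le> g y" if "1 \<le> x" "x \<le> y" "y \<le> t" for x y
      using stages_mono[OF assms, of x y] that t by simp
    show "h s < h t \<or> h s = h t \<and> r s = r t"
    proof (cases "g s = g t")
      case True
      have "g x \<in> g ` {1..s}" if "x \<in> {1..t}" for x
      proof (cases "x \<le> s")
        case False
        then have "g x = g s" using le[of s x] le[of x t] True that s by simp
        then show ?thesis using s by auto
      qed (use that in auto)
      then have "g ` {1..t} = g ` {1..s}" using t by auto
      then show ?thesis using stages_eq[OF assms, of s t] True s t by (auto simp: h_def)
    next
      case False
      then have "g s < g t" using le[of s t] s t by simp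
      have "g t \<notin> g ` {1..s}"
      proof
        assume "g t \<in> g ` {1..s}"
        then obtain x where "x \<in> {1..s}" "g t = g x" by blast
        then show False using le[of x s] \<open>g s < g t\<close> t by simp
      qed
      then have "g ` {1..s} \<subset> g ` {1..t}" using s t by auto
      then have "card (g ` {1..s}) < card (g ` {1..t})" by (intro psubset_card_mono) auto
      moreover have "1 \<le> card (g ` {1..s})"
        using s by (simp add: Suc_le_eq card_gt_0_iff)
      ultimately have "h s < h t" unfolding h_def by linarith
      then show ?thesis by simp
    qed
  qed
  then show ?thesis by blast
qed

text \<open>Truncated subtraction supplies the maximum with 0, so the machine computes a penalty by
  one addition and one subtraction.\<close>

lemma linear_penalty_nat: "linear_penalty (int a - int b) = a + 1 - b"
  unfolding linear_penalty_def by linarith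

text \<open>Replacing each rank by its position among the used ranks closes the gaps, which can only
  decrease the penalties.\<close>

lemma penalty_position_le:
  fixes X :: "nat set"
  assumes "finite X" "x \<in> X" "y \<in> X"
  shows "card {z \<in> X. z < x} + 1 - card {z \<in> X. z < y} \<le> x + 1 - y"
proof (cases "x < y")
  case True
  then have "{z \<in> X. z < x} \<subset> {z \<in> X. z < y}" using assms by auto
  then have "card {z \<in> X. z < x} < card {z \<in> X. z < y}"
    using assms(1) by (intro psubset_card_mono) auto
  then show ?thesis by simp
next
  case False
  have "card {z \<in> X. z < x} \<le> card ({z \<in> X. z < y} \<union> {y..<x})"
    using assms(1) by (intro card_mono) auto
  also have "\<dots> \<le> card {z \<in> X. z < y} + (x - y)"
    using card_Un_le[of "{z \<in> X. z < y}" "{y..<x}"] by simp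
  finally show ?thesis using False by simp
qed

lemma temporal_agony_mono:
  assumes "temporal_wdigraph G"
    and "\<And>t u v. t \<in> {1..lifetime G} \<Longrightarrow> u \<in> verts G \<Longrightarrow> v \<in> verts G \<Longrightarrow>
      p (int (r u t) - int (r v t)) \<le> p' (int (r' u t) - int (r' v t))"
  shows "temporal_agony r G p \<le> temporal_agony r' G p'"
  unfolding temporal_agony_def
proof (intro sum_mono)
  fix t x assume t: "t \<in> {1..lifetime G}" and x: "x \<in> arcs G t"
  have "arcs G t \<subseteq> verts G \<times> verts G"
    using assms(1) t unfolding temporal_wdigraph_def by blast
  with x have "fst x \<in> verts G" "snd x \<in> verts G" by auto
  then show "(case x of (u, v) \<Rightarrow> weight G t (u, v) * p (int (r u t) - int (r v t)))
    \<le> (case x of (u, v) \<Rightarrow> weight G t (u, v) * p' (int (r' u t) - int (r' v t)))"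
    using assms(2)[OF t, of "fst x" "snd x"] by (auto simp: split_beta)
qed

definition num_stages :: "'v tgraph \<Rightarrow> nat \<Rightarrow> nat" where
  "num_stages G l = min l (lifetime G) + 1"

definition num_ranks :: "'v tgraph \<Rightarrow> nat \<Rightarrow> nat \<Rightarrow> nat" where
  "num_ranks G k l = min k (card (verts G) * num_stages G l)"

text \<open>The search space becomes finite with a size independent of how large \<open>k\<close>
  and \<open>l\<close> are. Ranks start from 0 here, since they will serve as digits.\<close>

lemma seg_agony_normal_form:
  fixes G :: "'v tgraph"
  assumes G: "temporal_wdigraph G" and "1 \<le> lifetime G" "1 \<le> k"
  shows "seg_agony G k l \<alpha> \<longleftrightarrow>
    (\<exists>r g. (\<forall>v\<in>verts G. stages (lifetime G) (num_stages G l - 1) (r v) (g v)) \<and>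
       (\<forall>v\<in>verts G. \<forall>t\<in>{1..lifetime G}. r v t < num_ranks G k l) \<and>
       temporal_agony r G linear_penalty \<le> \<alpha>)"
    (is "_ \<longleftrightarrow> ?rhs")
proof
  let ?V = "verts G" and ?\<tau> = "lifetime G"
  assume "seg_agony G k l \<alpha>"
  then obtain r where seg: "rank_segmentation ?V ?\<tau> k l r"
    and le: "temporal_agony r G linear_penalty \<le> \<alpha>"
    unfolding seg_agony_def by blast
  have "\<exists>g. stages ?\<tau> (num_stages G l - 1) (r v) g" if "v \<in> ?V" for v
    using rank_segmentation_imp_stages[OF seg that] stages_clamp[of ?\<tau> l "r v"]
    by (auto simp: num_stages_def)
  then obtain g where g: "\<And>v. v \<in> ?V \<Longrightarrow> stages ?\<tau> (num_stages G l - 1) (r v) (g v)"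
    by metis
  define X where "X = (\<lambda>(v, t). r v t) ` (?V \<times> {1..?\<tau>})"
  have X: "r v t \<in> X" if "v \<in> ?V" "t \<in> {1..?\<tau>}" for v t
    using that by (auto simp: X_def)
  have fin: "finite X" "finite ?V" using G by (auto simp: X_def temporal_wdigraph_def)
  have "card X \<le> card {1..k}"
    using seg by (intro card_mono) (auto simp: X_def rank_segmentation_def)
  \<comment> \<open>All times in one stage of \<open>v\<close> share their rank, so an arbitrary
    choice among them recovers it, and there is at most one rank per vertex and stage.\<close>
  moreover have "X \<subseteq> (\<lambda>(v, i). r v (SOME t. t \<in> {1..?\<tau>} \<and> g v t = i)) `
      (?V \<times> {0..<num_stages G l})" (is "_ \<subseteq> ?f ` ?A")
  proof
    fix x assume "x \<in> X"
    then obtain v t where vt: "v \<in> ?V" "t \<in> {1..?\<tau>}" "x = r v t" by (auto simp: X_def)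
    let ?s = "SOME s. s \<in> {1..?\<tau>} \<and> g v s = g v t"
    have "?s \<in> {1..?\<tau>} \<and> g v ?s = g v t"
      by (rule someI[of _ t]) (use vt in auto)
    then have "x = ?f (v, g v t)" using stages_eq[OF g[OF vt(1)], of ?s t] vt by auto
    moreover have "(v, g v t) \<in> ?A"
      using g[OF vt(1)] vt by (auto simp: stages_def num_stages_def less_Suc_eq_le)
    ultimately show "x \<in> ?f ` ?A" by (rule image_eqI)
  qed
  then have "card X \<le> card ?A"
    using fin by (meson card_image_le card_mono finite_SigmaI finite_atLeastLessThan finite_imageI
      order_trans)
  ultimately have card: "card X \<le> num_ranks G k l"
    by (simp add: num_ranks_def card_cartesian_product)
  define r' where "r' v t = card {z \<in> X. z < r v t}" for v t
  have "r' v t < card X" if "v \<in> ?V" "t \<in> {1..?\<tau>}" for v t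
    unfolding r'_def using fin X[OF that] by (intro psubset_card_mono) auto
  then have "\<forall>v\<in>?V. \<forall>t\<in>{1..?\<tau>}. r' v t < num_ranks G k l"
    using card by fastforce
  \<comment> \<open>A position depends only on the rank it replaces: equal ranks stay equal, and the
    same \<open>g\<close> remains a certificate.\<close>
  moreover have "\<forall>v\<in>?V. stages ?\<tau> (num_stages G l - 1) (r' v) (g v)"
    using g unfolding stages_def r'_def by metis
  moreover have "temporal_agony r' G linear_penalty \<le> temporal_agony r G linear_penalty"
    using G penalty_position_le[OF fin(1) X X]
    by (intro temporal_agony_mono) (auto simp: linear_penalty_nat r'_def)
  ultimately show ?rhs using le by (intro exI[of _ r'] exI[of _ g] conjI) (assumption | linarith)+
next
  let ?V = "verts G" and ?\<tau> = "lifetime G"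
  assume ?rhs
  then obtain r g where st: "\<And>v. v \<in> ?V \<Longrightarrow> stages ?\<tau> (num_stages G l - 1) (r v) (g v)"
    and r: "\<And>v t. v \<in> ?V \<Longrightarrow> t \<in> {1..?\<tau>} \<Longrightarrow> r v t < num_ranks G k l"
    and le: "temporal_agony r G linear_penalty \<le> \<alpha>" by blast
  \<comment> \<open>The shift moves the ranks back into \<open>{1..k}\<close> and cancels in every
    difference.\<close>
  let ?r = "\<lambda>v t. r v t + 1"
  have "\<exists>g. stages ?\<tau> l (?r v) g" if "v \<in> ?V" for v
    using st[OF that] by (intro exI[of _ "g v"]) (auto simp: stages_def num_stages_def)
  moreover have "?r v t \<in> {1..k}" if "v \<in> ?V" "t \<in> {1..?\<tau>}" for v t
    using r[OF that] by (auto simp: num_ranks_def)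
  ultimately have "rank_segmentation ?V ?\<tau> k l ?r"
    using assms(2,3) by (intro stages_imp_rank_segmentation)
  moreover have "temporal_agony ?r G linear_penalty = temporal_agony r G linear_penalty"
    by (simp add: temporal_agony_def)
  ultimately show "seg_agony G k l \<alpha>" using le unfolding seg_agony_def by metis
qed

section \<open>Dynamic programming over encoded states\<close>

text \<open>A state assigns a stage below \<open>L\<close> and a rank below \<open>K\<close> to each of the \<open>n\<close> vertices. It is
  encoded as a number with mixed radix digits \<open>K, L, K, L, \<dots>\<close>.\<close>

definition rank_of :: "nat \<Rightarrow> nat \<Rightarrow> nat \<Rightarrow> nat \<Rightarrow> nat" where
  "rank_of K L x v = x div (K * L) ^ v mod K"

definition stage_of :: "nat \<Rightarrow> nat \<Rightarrow> nat \<Rightarrow> nat \<Rightarrow> nat" where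
  "stage_of K L x v = x div (K * L) ^ v div K mod L"

lemma rank_stage_Suc:
  "rank_of K L x (Suc v) = rank_of K L (x div K div L) v"
  "stage_of K L x (Suc v) = stage_of K L (x div K div L) v"
  by (simp_all add: rank_of_def stage_of_def div_mult2_eq[symmetric] mult.assoc)

text \<open>Horner's scheme, with vertex 0 in the least significant digits.\<close>

lemma encode_state:
  assumes "\<And>v. v < n \<Longrightarrow> r v < K" "\<And>v. v < n \<Longrightarrow> g v < L"
  shows "\<exists>x < (K * L) ^ n. \<forall>v<n. rank_of K L x v = r v \<and> stage_of K L x v = g v"
  using assms
proof (induction n arbitrary: r g)
  case (Suc n)
  obtain y where y: "y < (K * L) ^ n"
    "\<forall>v<n. rank_of K L y v = r (Suc v) \<and> stage_of K L y v = g (Suc v)"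
    using Suc.IH[of "\<lambda>v. r (Suc v)" "\<lambda>v. g (Suc v)"] Suc.prems by auto
  define x where "x = r 0 + K * (g 0 + L * y)"
  have r: "r 0 < K" "g 0 < L" using Suc.prems by auto
  then have div: "x div K = g 0 + L * y" "x mod K = r 0" "x div K div L = y" "x div K mod L = g 0"
    by (simp_all add: x_def)
  have "x div (K * L) < (K * L) ^ n" using div y by (simp add: div_mult2_eq)
  then have "x < (K * L) ^ Suc n"
    using r by (simp add: div_less_iff_less_mult mult.commute)
  moreover have "rank_of K L x v = r v \<and> stage_of K L x v = g v" if "v < Suc n" for v
    using that div y(2) by (cases v) (auto simp: rank_stage_Suc, auto simp: rank_of_def stage_of_def)
  ultimately show ?case by blast
qed simp

text \<open>The condition of \<open>stages\<close> between two times, read off the digits for all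
  vertices at once.\<close>

definition compatible :: "nat \<Rightarrow> nat \<Rightarrow> nat \<Rightarrow> nat \<Rightarrow> nat \<Rightarrow> bool" where
  "compatible n K L x y \<longleftrightarrow> (\<forall>v<n. stage_of K L x v < stage_of K L y v \<or>
     stage_of K L x v = stage_of K L y v \<and> rank_of K L x v = rank_of K L y v)"

text \<open>Here \<open>w\<close> is one adjacency matrix in row-major order. Non-arcs have entry 0,
  so the sum may run over all pairs.\<close>

definition state_cost :: "nat \<Rightarrow> nat \<Rightarrow> nat \<Rightarrow> (nat \<Rightarrow> nat) \<Rightarrow> nat \<Rightarrow> nat" where
  "state_cost n K L w x =
     (\<Sum>u<n. \<Sum>v<n. w (u * n + v) * (rank_of K L x u + 1 - rank_of K L x v))"

text \<open>The minimum starts from \<open>f y\<close>: a state is compatible with itself, so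
  keeping the state \<open>y\<close> is a legal first candidate.\<close>

primrec best :: "(nat \<Rightarrow> bool) \<Rightarrow> (nat \<Rightarrow> nat) \<Rightarrow> nat \<Rightarrow> nat \<Rightarrow> nat" where
  "best P f y 0 = f y"
| "best P f y (Suc x) = (if P x \<and> f x < best P f y x then f x else best P f y x)"

text \<open>Row 0 belongs to a fictitious time before the first, at which every state is free. Row
  \<open>Suc t\<close> uses the matrix at offset \<open>t * (n * n)\<close>, which is that of time
  \<open>Suc t\<close>.\<close>

primrec dp :: "nat \<Rightarrow> nat \<Rightarrow> nat \<Rightarrow> (nat \<Rightarrow> nat) \<Rightarrow> nat \<Rightarrow> nat \<Rightarrow> nat" where
  "dp n K L w 0 y = 0"
| "dp n K L w (Suc t) y =
     best (\<lambda>x. compatible n K L x y) (dp n K L w t) y ((K * L) ^ n) +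
     state_cost n K L (\<lambda>i. w (t * (n * n) + i)) y"

lemma best_le_iff: "best P f y m \<le> a \<longleftrightarrow> f y \<le> a \<or> (\<exists>x<m. P x \<and> f x \<le> a)"
  by (induction m) (auto simp: less_Suc_eq)

lemma compatible_refl: "compatible n K L x x"
  by (simp add: compatible_def)

lemma compatible_trans: "compatible n K L x y \<Longrightarrow> compatible n K L y z \<Longrightarrow> compatible n K L x z"
  unfolding compatible_def
proof (intro allI impI)
  fix v
  assume "\<forall>v<n. stage_of K L x v < stage_of K L y v \<or>
      stage_of K L x v = stage_of K L y v \<and> rank_of K L x v = rank_of K L y v"
    and "\<forall>v<n. stage_of K L y v < stage_of K L z v \<or>
      stage_of K L y v = stage_of K L z v \<and> rank_of K L y v = rank_of K L z v"
    and "v < n"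
  from this(1,2)[rule_format, OF this(3)]
  show "stage_of K L x v < stage_of K L z v \<or>
      stage_of K L x v = stage_of K L z v \<and> rank_of K L x v = rank_of K L z v"
    by auto
qed

text \<open>In threshold form, the recursion for minima becomes the extension of a path of states by
  its last step. The state \<open>f 0\<close> belongs to the fictitious time and incurs no
  cost.\<close>

lemma dp_le_iff:
  assumes "y < (K * L) ^ n"
  shows "dp n K L w t y \<le> a \<longleftrightarrow>
    (\<exists>f. f t = y \<and> (\<forall>i\<le>t. f i < (K * L) ^ n) \<and> (\<forall>i<t. compatible n K L (f i) (f (Suc i))) \<and>
      (\<Sum>i<t. state_cost n K L (\<lambda>j. w (i * (n * n) + j)) (f (Suc i))) \<le> a)"
  using assms
proof (induction t arbitrary: y a)
  case 0
  then show ?case by (auto intro: exI[of _ "\<lambda>_. y"])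
next
  case (Suc t)
  let ?S = "(K * L) ^ n" and ?c = "\<lambda>i. state_cost n K L (\<lambda>j. w (i * (n * n) + j))"
  let ?path = "\<lambda>t y a f. f t = y \<and> (\<forall>i\<le>t. f i < ?S) \<and>
    (\<forall>i<t. compatible n K L (f i) (f (Suc i))) \<and> (\<Sum>i<t. ?c i (f (Suc i))) \<le> a"
  \<comment> \<open>The difference \<open>a - ?c t y\<close> is truncated, so
    \<open>?c t y \<le> a\<close> has to be kept as a condition of its own.\<close>
  have "dp n K L w (Suc t) y \<le> a \<longleftrightarrow> ?c t y \<le> a \<and>
      best (\<lambda>x. compatible n K L x y) (dp n K L w t) y ?S \<le> a - ?c t y"
    by auto
  \<comment> \<open>The initial candidate of \<open>best\<close> is the case \<open>x = y\<close>,
    by reflexivity of compatibility.\<close>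
  also have "\<dots> \<longleftrightarrow> ?c t y \<le> a \<and> (\<exists>x<?S. compatible n K L x y \<and> dp n K L w t x \<le> a - ?c t y)"
    using Suc.prems compatible_refl by (auto simp: best_le_iff)
  also have "\<dots> \<longleftrightarrow> (\<exists>f. ?path (Suc t) y a f)"
  proof
    assume "?c t y \<le> a \<and> (\<exists>x<?S. compatible n K L x y \<and> dp n K L w t x \<le> a - ?c t y)"
    then obtain x f where "?c t y \<le> a" "x < ?S" "compatible n K L x y" "?path t x (a - ?c t y) f"
      using Suc.IH by blast
    then have "?path (Suc t) y a (f(Suc t := y))"
      using Suc.prems by (auto simp: less_Suc_eq le_Suc_eq)
    then show "\<exists>f. ?path (Suc t) y a f" by blast
  next
    assume "\<exists>f. ?path (Suc t) y a f"
    then obtain f where f: "?path (Suc t) y a f" by blast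
    then have "?path t (f t) (a - ?c t y) f" by auto
    moreover have "f t < ?S" "compatible n K L (f t) y" "?c t y \<le> a" using f by auto
    ultimately show "?c t y \<le> a \<and> (\<exists>x<?S. compatible n K L x y \<and> dp n K L w t x \<le> a - ?c t y)"
      using Suc.IH by blast
  qed
  finally show ?case .
qed

section \<open>The input layout and the temporal agony as a sum over matrix entries\<close>

lemma length_concat_map:
  assumes "\<And>x. x \<in> set xs \<Longrightarrow> length (f x) = m"
  shows "length (concat (map f xs)) = length xs * m"
  using assms by (induction xs) auto

lemma nth_concat_map:
  assumes "\<And>x. x \<in> set xs \<Longrightarrow> length (f x) = m" "i < length xs" "j < m"
  shows "concat (map f xs) ! (i * m + j) = f (xs ! i) ! j"
  using assms
proof (induction xs arbitrary: i)
  case (Cons x xs)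
  then show ?case by (cases i) (auto simp: nth_append add.assoc)
qed simp

lemma length_weight_list: "length (weight_list G) = lifetime G * (card (verts G) * card (verts G))"
  unfolding weight_list_def
  by (subst length_concat_map[where m = "card (verts G) * card (verts G)"])
    (simp_all add: length_concat_map[where m = "card (verts G)"])

lemma nth_weight_list:
  assumes "t < lifetime G" "i < card (verts G)" "j < card (verts G)"
  shows "weight_list G ! (t * (card (verts G) * card (verts G)) + (i * card (verts G) + j)) =
    (let a = (sorted_list_of_set (verts G) ! i, sorted_list_of_set (verts G) ! j)
     in if a \<in> arcs G (t + 1) then weight G (t + 1) a else 0)"
proof -
  let ?n = "card (verts G)"
  have "i * ?n + j < ?n * ?n"
  proof -
    have "i * ?n + j < (i + 1) * ?n" using assms by simp
    also have "\<dots> \<le> ?n * ?n" using assms by (intro mult_le_mono1) simp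
    finally show ?thesis .
  qed
  then show ?thesis
    unfolding weight_list_def using assms
    by (subst nth_concat_map[where m = "?n * ?n"])
      (simp_all add: length_concat_map[where m = ?n] nth_concat_map[where m = ?n] Let_def del: upt_Suc)
qed

text \<open>Zero entries extend each sum over arcs to all pairs of vertex positions, which gives the
  shape of \<open>state_cost\<close>. Times are shifted by one so that the first matrix has offset
  0.\<close>

lemma temporal_agony_conv_weights:
  fixes G :: "nat tgraph"
  assumes "temporal_wdigraph G"
  defines "n \<equiv> card (verts G)" and "vs \<equiv> sorted_list_of_set (verts G)"
  shows "temporal_agony r G linear_penalty =
    (\<Sum>t<lifetime G. \<Sum>i<n. \<Sum>j<n. cells (weight_list G) (t * (n * n) + (i * n + j)) *
       (r (vs ! i) (Suc t) + 1 - r (vs ! j) (Suc t)))"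
proof -
  have fin: "finite (verts G)" using assms by (simp add: temporal_wdigraph_def)
  have bij: "bij_betw ((!) vs) {..<n} (verts G)"
    unfolding vs_def n_def using fin by (intro bij_betw_nth) auto
  have "temporal_agony r G linear_penalty =
      (\<Sum>t<lifetime G. \<Sum>(u, v)\<in>arcs G (Suc t).
        weight G (Suc t) (u, v) * (r u (Suc t) + 1 - r v (Suc t)))"
    unfolding temporal_agony_def linear_penalty_nat
    by (simp add: sum.atLeast1_atMost_eq)
  also have "\<dots> = (\<Sum>t<lifetime G. \<Sum>i<n. \<Sum>j<n.
       cells (weight_list G) (t * (n * n) + (i * n + j)) *
       (r (vs ! i) (Suc t) + 1 - r (vs ! j) (Suc t)))"
  proof (intro sum.cong refl)
    fix t assume "t \<in> {..<lifetime G}"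
    then have t: "t < lifetime G" by simp
    let ?A = "arcs G (Suc t)"
    let ?f = "\<lambda>u v. weight G (Suc t) (u, v) * (r u (Suc t) + 1 - r v (Suc t))"
    let ?g = "\<lambda>u v. if (u, v) \<in> ?A then ?f u v else 0"
    have sub: "?A \<subseteq> verts G \<times> verts G"
      using assms(1) t by (simp add: temporal_wdigraph_def)
    have "(\<Sum>(u, v)\<in>?A. ?f u v) = (\<Sum>(u, v)\<in>verts G \<times> verts G. ?g u v)"
      using sub fin by (intro sum.mono_neutral_cong_left) auto
    also have "\<dots> = (\<Sum>u\<in>verts G. \<Sum>v\<in>verts G. ?g u v)"
      by (simp add: sum.cartesian_product)
    also have "\<dots> = (\<Sum>i<n. \<Sum>j<n. ?g (vs ! i) (vs ! j))"
      by (simp add: sum.reindex_bij_betw[OF bij, symmetric])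
    also have "\<dots> = (\<Sum>i<n. \<Sum>j<n. cells (weight_list G) (t * (n * n) + (i * n + j)) *
       (r (vs ! i) (Suc t) + 1 - r (vs ! j) (Suc t)))"
    proof (intro sum.cong refl)
      fix i j assume "i \<in> {..<n}" "j \<in> {..<n}"
      then have ij: "i < n" "j < n" by auto
      have "i * n + j < (i + 1) * n" using ij by simp
      also have "\<dots> \<le> n * n" using ij by (intro mult_le_mono1) simp
      finally have "t * (n * n) + (i * n + j) < (t + 1) * (n * n)" by simp
      also have "\<dots> \<le> lifetime G * (n * n)" using t by (intro mult_le_mono1) simp
      finally have "t * (n * n) + (i * n + j) < length (weight_list G)"
        by (simp add: length_weight_list n_def)
      then show "?g (vs ! i) (vs ! j) = cells (weight_list G) (t * (n * n) + (i * n + j)) *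
         (r (vs ! i) (Suc t) + 1 - r (vs ! j) (Suc t))"
        using t ij by (simp add: cells_def nth_weight_list n_def vs_def Let_def)
    qed
    finally show "(\<Sum>(u, v)\<in>?A. ?f u v) = \<dots>" .
  qed
  finally show ?thesis .
qed

lemma seg_agony_iff_dp:
  fixes G :: "nat tgraph" and k l \<alpha> :: nat
  assumes G: "temporal_wdigraph G" and "1 \<le> lifetime G" "1 \<le> k" "1 \<le> card (verts G)"
  defines "n \<equiv> card (verts G)" and "K \<equiv> num_ranks G k l" and "L \<equiv> num_stages G l"
  shows "seg_agony G k l \<alpha> \<longleftrightarrow>
    (\<exists>x < (K * L) ^ n. dp n K L (cells (weight_list G)) (lifetime G) x \<le> \<alpha>)"
proof -
  let ?V = "verts G" and ?\<tau> = "lifetime G" and ?w = "cells (weight_list G)" and ?S = "(K * L) ^ n"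
  define vs where "vs = sorted_list_of_set ?V"
  have fin: "finite ?V" using G by (simp add: temporal_wdigraph_def)
  have bij: "bij_betw ((!) vs) {..<n} ?V"
    unfolding vs_def n_def using fin by (intro bij_betw_nth) auto
  have KL: "0 < K" "0 < L"
    using assms by (auto simp: K_def L_def num_ranks_def num_stages_def n_def)
  show ?thesis
  proof
    assume "seg_agony G k l \<alpha>"
    then obtain r g where st: "\<And>v. v \<in> ?V \<Longrightarrow> stages ?\<tau> (L - 1) (r v) (g v)"
      and r: "\<And>v t. v \<in> ?V \<Longrightarrow> t \<in> {1..?\<tau>} \<Longrightarrow> r v t < K"
      and le: "temporal_agony r G linear_penalty \<le> \<alpha>"
      using seg_agony_normal_form[OF assms(1-3), of l \<alpha>] unfolding K_def L_def by blast
    have vs: "vs ! i \<in> ?V" if "i < n" for i using bij that by (auto simp: bij_betw_def)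
    have "\<exists>x<?S. \<forall>i<n. rank_of K L x i = r (vs ! i) t \<and> stage_of K L x i = g (vs ! i) t"
      if "t \<in> {1..?\<tau>}" for t
    proof (rule encode_state)
      fix i assume "i < n"
      then have "r (vs ! i) t < K" "g (vs ! i) t \<le> L - 1"
        using r[OF vs that] st[OF vs] that by (auto simp: stages_def)
      then show "r (vs ! i) t < K" "g (vs ! i) t < L" using KL by auto
    qed
    then obtain e where e: "\<And>t. t \<in> {1..?\<tau>} \<Longrightarrow> e t < ?S"
      "\<And>t i. t \<in> {1..?\<tau>} \<Longrightarrow> i < n \<Longrightarrow> rank_of K L (e t) i = r (vs ! i) t"
      "\<And>t i. t \<in> {1..?\<tau>} \<Longrightarrow> i < n \<Longrightarrow> stage_of K L (e t) i = g (vs ! i) t"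
      by metis
    \<comment> \<open>Repeating the state of time 1 at the fictitious time 0 makes the first
      transition compatible.\<close>
    define f where "f t = e (max 1 t)" for t
    have f: "f i < ?S" if "i \<le> ?\<tau>" for i using e(1) that assms(2) by (simp add: f_def)
    have "compatible n K L (f i) (f (Suc i))" if "i < ?\<tau>" for i
      unfolding compatible_def
    proof (intro allI impI)
      fix v assume "v < n"
      then have "stages ?\<tau> (L - 1) (r (vs ! v)) (g (vs ! v))" using st vs by blast
      moreover have "max 1 i \<in> {1..?\<tau>}" "Suc i \<in> {max 1 i..?\<tau>}" "Suc i \<in> {1..?\<tau>}"
        using that by auto
      ultimately have "g (vs ! v) (max 1 i) < g (vs ! v) (Suc i) \<or>
        g (vs ! v) (max 1 i) = g (vs ! v) (Suc i) \<and> r (vs ! v) (max 1 i) = r (vs ! v) (Suc i)"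
        unfolding stages_def by blast
      then show "stage_of K L (f i) v < stage_of K L (f (Suc i)) v \<or>
          stage_of K L (f i) v = stage_of K L (f (Suc i)) v \<and>
          rank_of K L (f i) v = rank_of K L (f (Suc i)) v"
        using e(2,3)[OF \<open>max 1 i \<in> _\<close> \<open>v < n\<close>] e(2,3)[OF \<open>Suc i \<in> {1..?\<tau>}\<close> \<open>v < n\<close>]
        by (simp add: f_def)
    qed
    moreover have "(\<Sum>t<?\<tau>. state_cost n K L (\<lambda>j. ?w (t * (n * n) + j)) (f (Suc t)))
        = temporal_agony r G linear_penalty"
      unfolding temporal_agony_conv_weights[OF G] state_cost_def n_def[symmetric] vs_def[symmetric]
      by (intro sum.cong refl) (simp add: f_def e)
    ultimately have "dp n K L ?w ?\<tau> (f ?\<tau>) \<le> \<alpha>"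
      using f le by (subst dp_le_iff) auto
    then show "\<exists>x<?S. dp n K L ?w ?\<tau> x \<le> \<alpha>" using f by blast
  next
    assume "\<exists>x<?S. dp n K L ?w ?\<tau> x \<le> \<alpha>"
    then obtain x where "x < ?S" "dp n K L ?w ?\<tau> x \<le> \<alpha>" by blast
    then obtain f where f: "\<And>i. i < ?\<tau> \<Longrightarrow> compatible n K L (f i) (f (Suc i))"
      and le: "(\<Sum>t<?\<tau>. state_cost n K L (\<lambda>j. ?w (t * (n * n) + j)) (f (Suc t))) \<le> \<alpha>"
      unfolding dp_le_iff[OF \<open>x < ?S\<close>] by blast
    define idx where "idx = inv_into {..<n} ((!) vs)"
    have idx: "idx v < n" if "v \<in> ?V" for v
      using bij that unfolding idx_def bij_betw_def by (metis inv_into_into lessThan_iff)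
    have idx_nth: "idx (vs ! i) = i" if "i < n" for i
      using bij that by (simp add: idx_def bij_betw_def)
    define r where "r v t = rank_of K L (f t) (idx v)" for v t
    define g where "g v t = stage_of K L (f t) (idx v)" for v t
    \<comment> \<open>Transitivity turns compatibility of consecutive states into the condition on
      all pairs of times that \<open>stages\<close> requires.\<close>
    have comp: "compatible n K L (f s) (f t)" if "s \<le> t" "t \<le> ?\<tau>" for s t
      using that
    proof (induction t rule: dec_induct)
      case (step t)
      then show ?case using f[of t] compatible_trans[of n K L "f s" "f t"] by simp
    qed (rule compatible_refl)
    have "stages ?\<tau> (L - 1) (r v) (g v)" if "v \<in> ?V" for v
      unfolding stages_def
    proof (intro conjI ballI)
      fix s t assume "s \<in> {1..?\<tau>}" "t \<in> {s..?\<tau>}"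
      then show "g v s < g v t \<or> g v s = g v t \<and> r v s = r v t"
        using comp[of s t] idx[OF that] by (auto simp: compatible_def r_def g_def)
    next
      fix t
      have "g v t < L" using KL by (simp add: g_def stage_of_def)
      then show "g v t \<le> L - 1" by simp
    qed
    moreover have "r v t < K" for v t
      using KL by (simp add: r_def rank_of_def)
    moreover have "temporal_agony r G linear_penalty =
        (\<Sum>t<?\<tau>. state_cost n K L (\<lambda>j. ?w (t * (n * n) + j)) (f (Suc t)))"
      unfolding temporal_agony_conv_weights[OF G] state_cost_def n_def[symmetric] vs_def[symmetric]
      by (intro sum.cong refl) (simp add: r_def idx_nth)
    ultimately show "seg_agony G k l \<alpha>"
      using le unfolding seg_agony_normal_form[OF assms(1-3), of l \<alpha>] K_def[symmetric] L_def[symmetric]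
      by (intro exI[of _ r] exI[of _ g]) simp
  qed
qed

section \<open>The program\<close>

text \<open>A frame condition: as each block writes only registers from some number on, one
  threshold tells what it preserves.\<close>

definition agree :: "nat \<Rightarrow> (nat \<Rightarrow> nat) \<Rightarrow> (nat \<Rightarrow> nat) \<Rightarrow> bool" where
  "agree m R R' \<longleftrightarrow> (\<forall>i<m. R' i = R i)"

lemma agreeD: "agree m R R' \<Longrightarrow> i < m \<Longrightarrow> R' i = R i"
  by (simp add: agree_def)

lemma agree_refl [simp]: "agree m R R"
  by (simp add: agree_def)

lemma agree_upd [simp]: "m \<le> i \<Longrightarrow> agree m R (R'(i := x)) \<longleftrightarrow> agree m R R'"
  by (auto simp: agree_def)

lemma agree_trans: "agree m R R' \<Longrightarrow> agree m' R' R'' \<Longrightarrow> m \<le> m' \<Longrightarrow> agree m R R''"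
  by (simp add: agree_def)

text \<open>Registers 0 to 4 hold the input \<open>n, \<tau>, k, l, \<alpha>\<close>; registers 7 to 11 hold \<open>L\<close>, \<open>K\<close>, \<open>(K * L) ^ n\<close>,
  the length of the input in memory, and \<open>n * n\<close>. Behind the input, the memory is filled with the
  values of \<open>dp\<close>, one row per time step; row 0 consists of the zeros that are there initially.
  Register 12 is the address of the next entry to be written, 13 the time step, 14 and 15 are the
  addresses of its weights and of the preceding row, and 16 and 17 are the new and the old state.
  A block only changes registers above those it reads its arguments from, and leaves its result in
  register 18 or 19.\<close>

definition compat_step :: com where
  "compat_step =
     divmod 20 8 23 ;; divmod 20 7 24 ;; divmod 21 8 25 ;; divmod 21 7 26 ;;
     If 24 26 Skip (If 26 24 (Op (Const 19 0))
       (If 23 25 (Op (Const 19 0)) (If 25 23 (Op (Const 19 0)) Skip))) ;;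
     Op (Add 22 22 6)"

definition compat_check :: com where
  "compat_check =
     Op (Add 20 17 5) ;; Op (Add 21 16 5) ;; Op (Const 19 1) ;; Op (Const 22 0) ;;
     While 22 0 compat_step"

definition find_best :: com where
  "find_best =
     Op (Add 28 15 16) ;; Op (Load 18 28) ;; Op (Const 17 0) ;;
     While 17 9 (
       compat_check ;;
       If 5 19 (Op (Add 28 15 17) ;; Op (Load 28 28) ;; If 28 18 (Op (Add 18 28 5)) Skip) Skip ;;
       Op (Add 17 17 6))"

text \<open>The weight pointer in register 24 is not reset between rows, since the matrix is stored
  row by row; register 25 likewise accumulates over all rows.\<close>

definition row_cost :: com where
  "row_cost =
     Op (Add 26 16 5) ;; Op (Const 27 0) ;;
     While 27 0 (
       divmod 26 8 28 ;; divmod 26 7 29 ;; Op (Sub 30 22 28) ;; Op (Load 31 24) ;;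
       muladd 25 31 30 32 ;; Op (Add 24 24 6) ;; Op (Add 27 27 6))"

definition cost :: com where
  "cost =
     Op (Const 25 0) ;; Op (Add 24 14 5) ;; Op (Add 20 16 5) ;; Op (Const 21 0) ;;
     While 21 0 (
       divmod 20 8 22 ;; divmod 20 7 23 ;; Op (Add 22 22 6) ;; row_cost ;; Op (Add 21 21 6)) ;;
     Op (Add 19 25 5)"

definition layer :: com where
  "layer =
     Op (Const 16 0) ;;
     While 16 9 (
       find_best ;; cost ;; Op (Add 18 18 19) ;; Op (Store 12 18) ;; Op (Add 12 12 6) ;;
       Op (Add 16 16 6)) ;;
     Op (Add 14 14 11) ;; Op (Add 15 15 9)"

definition search :: com where
  "search =
     Op (Const 16 0) ;; Op (Const 19 0) ;;
     While 16 9 (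
       Op (Add 28 15 16) ;; Op (Load 28 28) ;; If 4 28 Skip (Op (Const 19 1)) ;; Op (Add 16 16 6))"

text \<open>The inputs \<open>l\<close> and \<open>k\<close> are added only after the comparison
  with \<tau> or \<open>n * L\<close> has shown them to be smaller. \<open>muladd\<close>
  accumulates, so registers 8, 10, 11 and 12 rely on being 0 at the start.\<close>

definition prepare :: com where
  "prepare =
     If 3 1 (Op (Add 7 3 6)) (Op (Add 7 1 6)) ;;
     muladd 8 0 7 13 ;;
     If 2 8 (Op (Add 8 2 5)) Skip ;;
     muladd 12 8 7 13 ;;
     Op (Const 9 1) ;; Op (Const 13 0) ;;
     While 13 0 (
       Op (Const 14 0) ;; muladd 14 9 12 15 ;; Op (Add 9 14 5) ;; Op (Add 13 13 6)) ;;
     muladd 11 0 0 13 ;;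
     muladd 10 11 1 13 ;;
     Op (Add 12 10 9) ;; Op (Const 13 0) ;; Op (Const 14 0) ;; Op (Add 15 10 5)"

definition solver :: com where
  "solver =
     Op (Const 6 1) ;;
     If 5 0
       (If 5 2
         (If 5 1
           (prepare ;; While 13 1 (layer ;; Op (Add 13 13 6)) ;; search)
           (If 5 3 Skip (Op (Const 19 1))))
         Skip)
       (Op (Const 19 1))"

text \<open>\<open>Z\<close> dominates all states and all loop counts except \<tau>, and
  \<open>B\<close> dominates all computed numbers. The first condition on \<open>B\<close> covers
  addresses: the input cells, followed by \<open>\<tau> + 1\<close> rows of at most \<open>Z\<close>
  entries. The second covers table entries: \<tau> time steps with \<open>n * n\<close> weights up
  to \<open>W\<close>, each times a penalty of at most \<open>K\<close>.\<close>

locale seg_machine = machine b B u for b B u :: nat +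
  fixes n \<tau> K L S \<alpha> W Z :: nat and w :: "nat \<Rightarrow> nat"
  assumes pos: "0 < n" "0 < \<tau>" "0 < K" "0 < L"
    and S: "S = (K * L) ^ n"
    and w: "w i \<le> W"
    and Z: "n \<le> Z" "K \<le> Z" "L \<le> Z" "S \<le> Z"
    and B: "\<tau> * (n * n) + (\<tau> + 2) * Z + 2 \<le> B" "\<tau> * (n * n * W * Z) \<le> B"
begin

definition "consts R \<longleftrightarrow> R 0 = n \<and> R 1 = \<tau> \<and> R 4 = \<alpha> \<and> R 5 = 0 \<and> R 6 = 1 \<and> R 7 = L \<and>
  R 8 = K \<and> R 9 = S \<and> R 11 = n * n" for R :: "nat \<Rightarrow> nat"

lemma constsD:
  assumes "consts R"
  shows "R 0 = n" "R 1 = \<tau>" "R 4 = \<alpha>" "R 5 = 0" "R 6 = 1" "R (Suc 0) = \<tau>"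
    "R 7 = L" "R 8 = K" "R 9 = S" "R 11 = n * n"
  using assms by (simp_all add: consts_def)

lemma consts_upd [simp]: "12 \<le> i \<Longrightarrow> consts (R(i := x)) \<longleftrightarrow> consts R"
  by (simp add: consts_def)

lemma consts_agree: "consts R \<Longrightarrow> agree m R R' \<Longrightarrow> 12 \<le> m \<Longrightarrow> consts R'"
  by (simp add: consts_def agree_def)

lemma Z_B:
  "Z + 2 \<le> B" "n \<le> B" "K \<le> B" "L \<le> B" "S \<le> B" "1 \<le> B" "0 \<le> B" "\<tau> \<le> B" "n * n \<le> B"
  "Suc 0 \<le> B" "Suc Z \<le> B" "Z \<le> B"
proof -
  have "Z \<le> (\<tau> + 2) * Z" by simp
  then show "Z + 2 \<le> B" using B by linarith
  then show "n \<le> B" "K \<le> B" "L \<le> B" "S \<le> B" "1 \<le> B" "0 \<le> B" "Suc 0 \<le> B" "Suc Z \<le> B" "Z \<le> B"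
    using Z by auto
  have "1 * (n * n) \<le> \<tau> * (n * n)" using pos by (intro mult_le_mono1) simp
  then show "n * n \<le> B" using B by linarith
  have "\<tau> * 1 \<le> \<tau> * (n * n)" using pos by (intro mult_le_mono2) simp
  then show "\<tau> \<le> B" using B by linarith
qed

lemma mod_le_B: "x mod L \<le> B" "x mod K \<le> B"
  using order_trans[OF mod_le_divisor] Z_B(3,4) pos by auto

lemma div_digits: "x div (K * L) ^ v div K div L = x div (K * L) ^ Suc v"
  by (metis div_mult2_eq mult.commute power_Suc2)

lemma W_B: "n * (n * (W * Z)) \<le> B" "n * (W * Z) \<le> B" "W * Z \<le> B" "W \<le> B"
proof -
  have "1 * (n * (n * (W * Z))) \<le> \<tau> * (n * (n * (W * Z)))" using pos by (intro mult_le_mono1) simp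
  then show 1: "n * (n * (W * Z)) \<le> B" using B(2) unfolding mult.assoc by linarith
  have "1 * (n * (W * Z)) \<le> n * (n * (W * Z))" using pos by (intro mult_le_mono1) simp
  with 1 show 2: "n * (W * Z) \<le> B" by linarith
  have "1 * (W * Z) \<le> n * (W * Z)" using pos by (intro mult_le_mono1) simp
  with 2 show 3: "W * Z \<le> B" by linarith
  have "W * 1 \<le> W * Z" using pos Z by (intro mult_le_mono2) simp
  with 3 show "W \<le> B" by linarith
qed

lemma rank_of_less: "rank_of K L x v < K"
  using pos by (simp add: rank_of_def)

lemma div_le_Z: "x \<le> Z \<Longrightarrow> x div y \<le> Z"
  by (rule order_trans[OF div_le_dividend])

text \<open>The choice \<open>T = Z\<close> fits all divisions, because only states and their
  quotients are ever divided.\<close>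

lemmas wp_intros = wp_Seq wp_If wp_Skip wp_Const wp_Add wp_Sub wp_Load wp_Store
  wp_divmod[where T = Z]

lemmas bounds = Z_B pos Z mod_le_B div_le_Z W_B

text \<open>The machine can only test for less, so equality of stages or ranks is the failure of
  both strict comparisons. The flag in register 19 is only ever cleared.\<close>

lemma wp_compat_step:
  assumes "consts R" "R 20 = p" "R 21 = q" "R 22 = v" "R 19 = f" "p \<le> Z" "q \<le> Z" "v < n"
  shows "wp compat_step (R, M) (12 * Z + 24) (\<lambda>(R', M'). M' = M \<and> agree 19 R R' \<and>
    R' 20 = p div K div L \<and> R' 21 = q div K div L \<and> R' 22 = Suc v \<and>
    R' 19 = (if p div K mod L < q div K mod L \<or>
      p div K mod L = q div K mod L \<and> p mod K = q mod K then f else 0))"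
proof -
  have "v \<le> B" using assms(8) Z_B(2) by simp
  note facts = assms constsD[OF assms(1)] bounds this
  show ?thesis
    unfolding compat_step_def
    \<comment> \<open>\<open>wp_time\<close> leaves the time schematic; the rules accumulate it
      along the code, and the last goal compares it with the claimed bound.\<close>
    by (rule wp_time, (rule wp_intros | (simp add: facts; fail))+)
qed

text \<open>At most \<open>Z\<close> vertices, and four digit extractions of \<open>3 * Z\<close>
  units for each. The later bounds are built in the same way, with \<open>Z\<close> in place of
  every loop count.\<close>

definition "t_check = Z * (12 * Z + 25) + 5"

lemma wp_compat_check:
  assumes "consts R" "R 17 = x" "R 16 = y" "x \<le> Z" "y \<le> Z"
  shows "wp compat_check (R, M) t_check (\<lambda>(R', M'). M' = M \<and> agree 19 R R' \<and>
    R' 19 = (if compatible n K L x y then 1 else 0))"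
proof -
  note facts = assms constsD[OF assms(1)] bounds
  let ?C = "\<lambda>v. stage_of K L x v < stage_of K L y v \<or>
    stage_of K L x v = stage_of K L y v \<and> rank_of K L x v = rank_of K L y v"
  let ?I = "\<lambda>v R' M'. M' = M \<and> agree 19 R R' \<and> R' 20 = x div (K * L) ^ v \<and>
    R' 21 = y div (K * L) ^ v \<and> R' 22 = v \<and> R' 19 = (if \<forall>i<v. ?C i then 1 else 0)"
  have loop: "wp (While 22 0 compat_step) (R', M') (n * (1 + (12 * Z + 24)) + 1)
      (\<lambda>(R', M'). M' = M \<and> agree 19 R R' \<and> R' 19 = (if compatible n K L x y then 1 else 0))"
    if "?I 0 R' M'" for R' M'
  proof (rule wp_While[where I = ?I])
    fix v R' M' assume v: "v < n" and I: "?I v R' M'"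
    then have c: "consts R'" using consts_agree[OF assms(1), of 19 R'] by simp
    have "wp compat_step (R', M') (12 * Z + 24) (\<lambda>(R', M'). ?I (Suc v) R' M')"
    proof (rule wp_mono[OF wp_compat_step[OF c refl refl refl refl]])
      fix s assume "case s of (R'', M'') \<Rightarrow> M'' = M' \<and> agree 19 R' R'' \<and>
        R'' 20 = R' 20 div K div L \<and> R'' 21 = R' 21 div K div L \<and> R'' 22 = Suc (R' 22) \<and>
        R'' 19 = (if R' 20 div K mod L < R' 21 div K mod L \<or>
          R' 20 div K mod L = R' 21 div K mod L \<and> R' 20 mod K = R' 21 mod K then R' 19 else 0)"
      then show "case s of (R', M') \<Rightarrow> ?I (Suc v) R' M'"
        using I by (auto simp: All_less_Suc div_digits stage_of_def rank_of_def elim: agree_trans)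
    qed (use I v assms div_le_Z in auto)
    then show "R' 22 < R' 0 \<and> R' 0 \<le> B \<and>
        wp compat_step (R', M') (12 * Z + 24) (\<lambda>(R', M'). ?I (Suc v) R' M')"
      using I v constsD[OF c] Z_B by simp
  next
    fix R' M' assume I: "?I n R' M'"
    then have c: "consts R'" using consts_agree[OF assms(1), of 19 R'] by simp
    show "\<not> R' 22 < R' 0 \<and> R' 0 \<le> B \<and> (case (R', M') of (R', M') \<Rightarrow> M' = M \<and> agree 19 R R' \<and>
        R' 19 = (if compatible n K L x y then 1 else 0))"
      using I constsD[OF c] Z_B by (simp add: compatible_def)
  qed (rule that)
  have t: "1 + (1 + (1 + (1 + (n * (1 + (12 * Z + 24)) + 1)))) \<le> t_check"
  proof -
    have "n * (1 + (12 * Z + 24)) \<le> Z * (12 * Z + 25)" by (rule mult_le_mono) (use Z in auto)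
    then show ?thesis unfolding t_check_def by linarith
  qed
  have xy_B: "x \<le> B" "y \<le> B" using assms Z_B by auto
  show ?thesis
    unfolding compat_check_def
    by (rule wp_time, (rule wp_intros loop | (simp add: facts xy_B; fail))+) (use t in simp)
qed

lemma best_le: "best P f y m \<le> f y"
  by (simp add: best_le_iff)

definition "t_best = Z * (t_check + 8) + 4"

lemma wp_find_best:
  assumes "consts R" "R 15 = p" "R 16 = y" "y < S" "p + S \<le> B"
    and f: "\<And>x. x < S \<Longrightarrow> M (p + x) = f x" "\<And>x. x < S \<Longrightarrow> f x \<le> B"
  shows "wp find_best (R, M) t_best (\<lambda>(R', M'). M' = M \<and> agree 17 R R' \<and>
    R' 18 = best (\<lambda>x. compatible n K L x y) f y S)"
proof -
  have pB: "p \<le> B" using assms(5) by simp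
  note facts = assms constsD[OF assms(1)] bounds pB
  let ?best = "best (\<lambda>x. compatible n K L x y) f y"
  let ?I = "\<lambda>x R' M'. M' = M \<and> agree 17 R R' \<and> R' 17 = x \<and> R' 18 = ?best x"
  let ?upd = "If 5 19 (Op (Add 28 15 17) ;; Op (Load 28 28) ;; If 28 18 (Op (Add 18 28 5)) Skip) Skip ;;
       Op (Add 17 17 6)"
  let ?body = "compat_check ;; ?upd"
  have loop: "wp (While 17 9 ?body) (R', M') (S * (1 + (t_check + 7)) + 1)
      (\<lambda>(R', M'). M' = M \<and> agree 17 R R' \<and> R' 18 = ?best S)"
    if "?I 0 R' M'" for R' M'
  proof (rule wp_While[where I = ?I])
    fix x R' M' assume x: "x < S" and I: "?I x R' M'"
    then have c: "consts R'" and R': "R' 16 = y" "R' 15 = p" "R' 17 = x" "R' 18 = ?best x"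
      using consts_agree[OF assms(1), of 17 R'] agreeD[of 17 R R'] assms by simp_all
    have upd: "wp ?upd (R'', M) 7 (\<lambda>(R', M'). ?I (Suc x) R' M')"
      if R'': "agree 19 R' R''" "R'' 19 = (if compatible n K L x y then 1 else 0)" for R''
    proof -
      have c': "consts R''" using consts_agree[OF c, of 19 R''] R'' by simp
      have v: "R'' 15 = p" "R'' 17 = x" "R'' 18 = ?best x"
        using R'' R' by (simp_all add: agreeD[of 19 R' R''])
      have a: "agree 17 R R''" using agree_trans[of 17 R R' 19 R''] I R'' by simp
      have "?best x \<le> B" "x \<le> B" "p + x \<le> B"
        using order_trans[of "?best x" "f y" B] best_le f(2)[OF assms(4)] x Z_B assms(5) by auto
      note facts' = constsD[OF c'] v f x a bounds pB R''(2) this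
      show ?thesis
        by (rule wp_time, (rule wp_intros | (simp add: facts' split: if_splits; fail))+)
    qed
    have "wp ?body (R', M') (t_check + 7) (\<lambda>(R', M'). ?I (Suc x) R' M')"
    proof (rule wp_Seq, rule wp_mono[OF wp_compat_check[OF c R'(3) R'(1)]])
      fix s assume "case s of (R'', M'') \<Rightarrow> M'' = M' \<and> agree 19 R' R'' \<and>
        R'' 19 = (if compatible n K L x y then 1 else 0)"
      then show "wp ?upd s 7 (\<lambda>(R', M'). ?I (Suc x) R' M')"
        using upd I by (cases s) simp
    qed (use x assms Z in auto)
    then show "R' 17 < R' 9 \<and> R' 9 \<le> B \<and>
        wp ?body (R', M') (t_check + 7) (\<lambda>(R', M'). ?I (Suc x) R' M')"
      using I x constsD[OF c] Z_B by simp
  next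
    fix R' M' assume I: "?I S R' M'"
    then have c: "consts R'" using consts_agree[OF assms(1), of 17 R'] by simp
    show "\<not> R' 17 < R' 9 \<and> R' 9 \<le> B \<and>
        (case (R', M') of (R', M') \<Rightarrow> M' = M \<and> agree 17 R R' \<and> R' 18 = ?best S)"
      using I constsD[OF c] Z_B by simp
  qed (rule that)
  have t: "1 + (1 + (1 + (S * (1 + (t_check + 7)) + 1))) \<le> t_best"
  proof -
    have "S * (1 + (t_check + 7)) \<le> Z * (t_check + 8)" by (rule mult_le_mono) (use Z in auto)
    then show ?thesis unfolding t_best_def by linarith
  qed
  have py_B: "p + y \<le> B" "y \<le> B" using assms(4,5) by auto
  show ?thesis
    unfolding find_best_def
    by (rule wp_time, (rule wp_intros loop | (simp add: facts f py_B; fail))+) (use t in simp)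
qed

definition "t_row = Z * (9 * Z + 15) + 3"

text \<open>The accumulator arrives with the sum \<open>a\<close> of earlier rows, so the last
  hypothesis reserves room for one more row of maximal cost. The time is free of \<open>W\<close>,
  because weights are only addends.\<close>

lemma wp_row_cost:
  assumes "consts R" "R 16 = y" "R 22 = c" "R 24 = p" "R 25 = a" "y \<le> Z" "c \<le> Z"
    and g: "\<And>v. v < n \<Longrightarrow> M (p + v) = g v" "\<And>v. v < n \<Longrightarrow> g v \<le> W"
    and B: "p + n \<le> B" "a + n * (W * Z) \<le> B"
  shows "wp row_cost (R, M) t_row (\<lambda>(R', M'). M' = M \<and> agree 24 R R' \<and> R' 24 = p + n \<and>
    R' 25 = a + (\<Sum>v<n. g v * (c - rank_of K L y v)))"
proof -
  note facts = assms constsD[OF assms(1)] bounds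
  let ?s = "\<lambda>v. a + (\<Sum>v<v. g v * (c - rank_of K L y v))"
  let ?I = "\<lambda>v R' M'. M' = M \<and> agree 24 R R' \<and> R' 24 = p + v \<and> R' 25 = ?s v \<and>
    R' 26 = y div (K * L) ^ v \<and> R' 27 = v"
  let ?body = "divmod 26 8 28 ;; divmod 26 7 29 ;; Op (Sub 30 22 28) ;; Op (Load 31 24) ;;
       muladd 25 31 30 32 ;; Op (Add 24 24 6) ;; Op (Add 27 27 6)"
  have gZ: "g v * (c - x) \<le> W * Z" if "v < n" for v x
    using g(2)[OF that] assms(7) by (intro mult_le_mono) auto
  have sB: "?s v \<le> B" if "v \<le> n" for v
  proof -
    have "(\<Sum>v<v. g v * (c - rank_of K L y v)) \<le> v * (W * Z)"
      using sum_bounded_above[of "{..<v}" "\<lambda>v. g v * (c - rank_of K L y v)" "W * Z"] gZ that by simp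
    also have "\<dots> \<le> n * (W * Z)" using that by (rule mult_le_mono1)
    finally show ?thesis using B(2) by linarith
  qed
  have loop: "wp (While 27 0 ?body) (R', M') (n * (1 + (9 * Z + 14)) + 1)
      (\<lambda>(R', M'). M' = M \<and> agree 24 R R' \<and> R' 24 = p + n \<and> R' 25 = ?s n)"
    if "?I 0 R' M'" for R' M'
  proof (rule wp_While[where I = ?I])
    fix v R' M' assume v: "v < n" and I: "?I v R' M'"
    then have c: "consts R'" and R': "R' 22 = c" and v_B: "v \<le> B" "p + v \<le> B"
      using consts_agree[OF assms(1), of 24 R'] agreeD[of 24 R R'] assms Z_B by simp_all
    have gB: "g v \<le> B" using g(2)[OF v] W_B(4) by linarith
    have cB: "c - x \<le> B" "c - x \<le> Z" "c \<le> B" for x using assms(7) Z_B by auto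
    have sum: "?s v + g v * (c - y div (K * L) ^ v mod K) = ?s (Suc v)" by (simp add: rank_of_def)
    have sumB: "?s v + g v * (c - y div (K * L) ^ v mod K) \<le> B"
      using sB[of "Suc v"] v unfolding sum by simp
    have "wp ?body (R', M') (3 * Z + 4 + (3 * Z + 4 + (1 + (1 + ((3 * (c - y div (K * L) ^ v mod K) + 2) + (1 + 1))))))
        (\<lambda>(R', M'). ?I (Suc v) R' M')"
      by (rule wp_intros wp_muladd[where a = "?s v" and x = "g v" and y = "c - y div (K * L) ^ v mod K"] |
        (use I R' v_B gB cB sumB in \<open>simp add: div_digits rank_of_def g(1)[OF v] constsD[OF c] assms(6) bounds\<close>; fail))+
    then have "wp ?body (R', M') (9 * Z + 14) (\<lambda>(R', M'). ?I (Suc v) R' M')"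
      by (rule wp_time) (use cB(2)[of "y div (K * L) ^ v mod K"] in simp)
    then show "R' 27 < R' 0 \<and> R' 0 \<le> B \<and> wp ?body (R', M') (9 * Z + 14) (\<lambda>(R', M'). ?I (Suc v) R' M')"
      using I v constsD[OF c] Z_B by simp
  next
    fix R' M' assume I: "?I n R' M'"
    then have c: "consts R'" using consts_agree[OF assms(1), of 24 R'] by simp
    show "\<not> R' 27 < R' 0 \<and> R' 0 \<le> B \<and> (case (R', M') of (R', M') \<Rightarrow>
        M' = M \<and> agree 24 R R' \<and> R' 24 = p + n \<and> R' 25 = ?s n)"
      using I constsD[OF c] Z_B by simp
  qed (rule that)
  have t: "1 + (1 + (n * (1 + (9 * Z + 14)) + 1)) \<le> t_row"
  proof -
    have "n * (1 + (9 * Z + 14)) \<le> Z * (9 * Z + 15)" by (rule mult_le_mono) (use Z in auto)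
    then show ?thesis unfolding t_row_def by linarith
  qed
  have y_B: "y \<le> B" using assms(6) Z_B by simp
  show ?thesis
    unfolding row_cost_def
    by (rule wp_time, (rule wp_intros loop | (simp add: facts y_B; fail))+) (use t in simp)
qed

definition "t_cost = Z * (6 * Z + t_row + 12) + 6"

lemma wp_cost:
  assumes "consts R" "R 16 = y" "R 14 = p" "y \<le> Z" "p + n * n \<le> B"
    and g: "\<And>i. i < n * n \<Longrightarrow> M (p + i) = g i" "\<And>i. i < n * n \<Longrightarrow> g i \<le> W"
  shows "wp cost (R, M) t_cost (\<lambda>(R', M'). M' = M \<and> agree 19 R R' \<and> R' 19 = state_cost n K L g y)"
proof -
  let ?row = "\<lambda>u. \<Sum>v<n. g (u * n + v) * (rank_of K L y u + 1 - rank_of K L y v)"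
  let ?s = "\<lambda>u. \<Sum>u<u. ?row u"
  let ?I = "\<lambda>u R' M'. M' = M \<and> agree 19 R R' \<and> R' 20 = y div (K * L) ^ u \<and> R' 21 = u \<and>
    R' 24 = p + u * n \<and> R' 25 = ?s u"
  let ?tail = "row_cost ;; Op (Add 21 21 6)"
  let ?body = "divmod 20 8 22 ;; divmod 20 7 23 ;; Op (Add 22 22 6) ;; ?tail"
  have idx: "u * n + v < n * n" if "u < n" "v < n" for u v
    using mult_le_mono1[of "Suc u" n n] that by simp
  have row_le: "?row u \<le> n * (W * Z)" if "u < n" for u
  proof -
    have "?row u \<le> of_nat (card {..<n}) * (W * Z)"
    proof (intro sum_bounded_above mult_le_mono)
      fix v assume "v \<in> {..<n}"
      then show "g (u * n + v) \<le> W" using g(2) idx that by simp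
      show "rank_of K L y u + 1 - rank_of K L y v \<le> Z"
        using rank_of_less[of y u] Z by linarith
    qed
    then show ?thesis by simp
  qed
  have s_le: "?s u \<le> u * (n * (W * Z))" if "u \<le> n" for u
  proof -
    have "?s u \<le> of_nat (card {..<u}) * (n * (W * Z))"
      by (intro sum_bounded_above) (use row_le that in simp)
    then show ?thesis by simp
  qed
  have s_B: "?s u \<le> B" if "u \<le> n" for u
    using s_le[OF that] mult_le_mono1[OF that, of "n * (W * Z)"] W_B(1) by linarith
  have tail: "wp ?tail (R1, M) (t_row + 1) (\<lambda>(R', M'). ?I (Suc u) R' M')"
    if u: "u < n" and c: "consts R1" and R1: "R1 16 = y" "R1 22 = rank_of K L y u + 1"
      "R1 20 = y div (K * L) ^ Suc u" "R1 21 = u" "R1 24 = p + u * n" "R1 25 = ?s u" "agree 19 R R1"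
    for u R1
  proof (rule wp_Seq, rule wp_mono[OF wp_row_cost[where c = "rank_of K L y u + 1" and y = y
        and p = "p + u * n" and a = "?s u" and g = "\<lambda>v. g (u * n + v)"]])
    have u_B: "u \<le> B" using u Z_B(2) by linarith
    fix s assume s: "case s of (R', M') \<Rightarrow> M' = M \<and> agree 24 R1 R' \<and> R' 24 = p + u * n + n \<and>
      R' 25 = ?s u + ?row u"
    obtain R' M' where s_eq: "s = (R', M')" by (cases s)
    have a: "agree 24 R1 R'" and R': "M' = M" "R' 24 = p + u * n + n" "R' 25 = ?s (Suc u)"
      using s unfolding s_eq by auto
    have "agree 19 R R'" using agree_trans[OF R1(7) a] by simp
    then show "wp (Op (Add 21 21 6)) s 1 (\<lambda>(R', M'). ?I (Suc u) R' M')"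
      unfolding s_eq using R' R1 agreeD[OF a] constsD[OF c] u_B Z_B
      by (intro wp_Add) simp_all
  next
    show "rank_of K L y u + 1 \<le> Z" using rank_of_less[of y u] Z by linarith
    have "n * (W * Z) + u * (n * (W * Z)) \<le> n * (n * (W * Z))"
      using mult_le_mono1[of "Suc u" n "n * (W * Z)"] u by simp
    then show "?s u + n * (W * Z) \<le> B" using s_le[of u] u W_B(1) by linarith
    have "u * n + n \<le> n * n" using mult_le_mono1[of "Suc u" n n] u by simp
    then show "p + u * n + n \<le> B" using assms(5) by linarith
    fix v assume v: "v < n"
    show "M (p + u * n + v) = g (u * n + v)" "g (u * n + v) \<le> W"
      using g idx[OF u v] by (simp_all add: add.assoc)
  qed (use that assms(4) in auto)
  have loop: "wp (While 21 0 ?body) (R', M') (n * (1 + (6 * Z + 9 + (t_row + 1))) + 1)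
      (\<lambda>(R', M'). wp (Op (Add 19 25 5)) (R', M') 1 (\<lambda>(R', M'). M' = M \<and> agree 19 R R' \<and> R' 19 = state_cost n K L g y))"
    if "?I 0 R' M'" for R' M'
  proof (rule wp_While[where I = ?I])
    fix u R' M' assume u: "u < n" and I: "?I u R' M'"
    then have c: "consts R'" and R': "R' 16 = y"
      using consts_agree[OF assms(1), of 19 R'] agreeD[of 19 R R'] assms by simp_all
    have "wp ?body (R', M) (6 * Z + 9 + (t_row + 1)) (\<lambda>(R', M'). ?I (Suc u) R' M')"
      by (rule wp_time, (rule tail[OF u] wp_intros(1,5,9) |
        (use I R' in \<open>simp add: div_digits rank_of_def constsD[OF c] c assms(4) bounds\<close>; fail))+)
    then show "R' 21 < R' 0 \<and> R' 0 \<le> B \<and>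
        wp ?body (R', M') (6 * Z + 9 + (t_row + 1)) (\<lambda>(R', M'). ?I (Suc u) R' M')"
      using I u constsD[OF c] Z_B by simp
  next
    fix R' M' assume I: "?I n R' M'"
    then have c: "consts R'" using consts_agree[OF assms(1), of 19 R'] by simp
    have "wp (Op (Add 19 25 5)) (R', M') 1 (\<lambda>(R', M'). M' = M \<and> agree 19 R R' \<and> R' 19 = state_cost n K L g y)"
      using I constsD[OF c] Z_B s_B[of n] by (intro wp_Add) (simp_all add: state_cost_def)
    then show "\<not> R' 21 < R' 0 \<and> R' 0 \<le> B \<and> (case (R', M') of (R', M') \<Rightarrow> wp (Op (Add 19 25 5)) (R', M') 1
        (\<lambda>(R', M'). M' = M \<and> agree 19 R R' \<and> R' 19 = state_cost n K L g y))"
      using I constsD[OF c] Z_B by simp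
  qed (rule that)
  have t: "1 + (1 + (1 + (1 + (n * (1 + (6 * Z + 9 + (t_row + 1))) + 1 + 1)))) \<le> t_cost"
  proof -
    have "n * (1 + (6 * Z + 9 + (t_row + 1))) \<le> Z * (6 * Z + t_row + 12)"
      by (rule mult_le_mono) (use Z in auto)
    then show ?thesis unfolding t_cost_def by linarith
  qed
  have y_B: "y \<le> B" "p \<le> B" using assms Z_B by auto
  note facts = assms(1-5) constsD[OF assms(1)] bounds
  have "wp (While 21 0 ?body ;; Op (Add 19 25 5)) (R', M') (n * (1 + (6 * Z + 9 + (t_row + 1))) + 1 + 1)
      (\<lambda>(R', M'). M' = M \<and> agree 19 R R' \<and> R' 19 = state_cost n K L g y)"
    if "?I 0 R' M'" for R' M'
    by (rule wp_Seq, rule wp_mono[OF loop[OF that]]) auto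
  note loop' = this
  show ?thesis
    unfolding cost_def
    by (rule wp_time, (rule loop' wp_intros(1,4,5) | (simp add: facts y_B; fail))+) (use t in simp)
qed

section \<open>Size of the table entries and layout of the table\<close>

lemma state_cost_le:
  assumes "\<And>i. i < n * n \<Longrightarrow> g i \<le> W"
  shows "state_cost n K L g y \<le> n * (n * (W * Z))"
proof -
  have "(\<Sum>v<n. g (i * n + v) * (rank_of K L y i + 1 - rank_of K L y v)) \<le> n * (W * Z)" if i: "i < n" for i
  proof -
    have "(\<Sum>v<n. g (i * n + v) * (rank_of K L y i + 1 - rank_of K L y v)) \<le> of_nat (card {..<n}) * (W * Z)"
    proof (intro sum_bounded_above mult_le_mono)
      fix v assume "v \<in> {..<n}"
      then have "i * n + v < n * n" using mult_le_mono1[of "Suc i" n n] i by simp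
      then show "g (i * n + v) \<le> W" by (rule assms)
      show "rank_of K L y i + 1 - rank_of K L y v \<le> Z"
        using rank_of_less[of y i] Z by linarith
    qed
    then show ?thesis by simp
  qed
  then have "state_cost n K L g y \<le> of_nat (card {..<n}) * (n * (W * Z))"
    unfolding state_cost_def by (intro sum_bounded_above) simp
  then show ?thesis by simp
qed

text \<open>Never leaving the state \<open>y\<close> is an admissible path, and each time step adds
  at most the maximal cost of a state.\<close>

lemma dp_le: "dp n K L w t y \<le> t * (n * (n * (W * Z)))"
proof (induction t arbitrary: y)
  case (Suc t)
  have "dp n K L w (Suc t) y \<le> dp n K L w t y + state_cost n K L (\<lambda>i. w (t * (n * n) + i)) y"
    using best_le by simp
  also have "\<dots> \<le> t * (n * (n * (W * Z))) + n * (n * (W * Z))"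
    using Suc state_cost_le w by (intro add_mono) auto
  finally show ?case by simp
qed simp

lemma dp_le_B: "t \<le> \<tau> \<Longrightarrow> dp n K L w t y \<le> B"
  using dp_le[of t y] mult_le_mono1[of t \<tau> "n * (n * (W * Z))"] B(2)
  unfolding mult.assoc by linarith

definition "base = \<tau> * (n * n)"

text \<open>The intended final memory. Cells are filled in increasing order, so an invariant only
  has to say how long a prefix already agrees with it.\<close>

definition table :: "nat \<Rightarrow> nat" where
  "table a = (if a < base then w a else dp n K L w ((a - base) div S) ((a - base) mod S))"

lemma table_input: "a < base \<Longrightarrow> table a = w a"
  by (simp add: table_def)

lemma table_dp: "x < S \<Longrightarrow> table (base + t * S + x) = dp n K L w t x"
  by (simp add: table_def)

text \<open>Row \<open>t\<close> is complete and row \<open>Suc t\<close> comes next. For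
  \<open>t = 0\<close> the row counts as written, since the memory behind the input is 0 from the
  start.\<close>

definition at_layer :: "nat \<Rightarrow> (nat \<Rightarrow> nat) \<Rightarrow> (nat \<Rightarrow> nat) \<Rightarrow> bool" where
  "at_layer t R M \<longleftrightarrow> consts R \<and> R 12 = base + Suc t * S \<and> R 13 = t \<and> R 14 = t * (n * n) \<and>
     R 15 = base + t * S \<and> (\<forall>a < base + Suc t * S. M a = table a)"

definition "t_layer = Z * (t_best + t_cost + 5) + 4"

text \<open>The weights and row \<open>t\<close> lie below the address \<open>q\<close> at which row
  \<open>Suc t\<close> begins, and all stores go to \<open>q\<close> or above, so they never disturb
  what is still to be read.\<close>

lemma wp_layer:
  assumes at: "at_layer t R M" and t: "t < \<tau>"
  shows "wp (layer ;; Op (Add 13 13 6)) (R, M) (t_layer + 1) (\<lambda>(R, M). at_layer (Suc t) R M)"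
proof -
  define q where "q = base + Suc t * S"
  let ?I = "\<lambda>y R M. consts R \<and> R 12 = q + y \<and> R 13 = t \<and> R 14 = t * (n * n) \<and>
     R 15 = base + t * S \<and> R 16 = y \<and> (\<forall>a < q + y. M a = table a)"
  let ?tail = "Op (Add 18 18 19) ;; Op (Store 12 18) ;; Op (Add 12 12 6) ;; Op (Add 16 16 6)"
  let ?body = "find_best ;; cost ;; ?tail"
  let ?end = "Op (Add 14 14 11) ;; Op (Add 15 15 9)"
  have "Suc (Suc t) * S \<le> (\<tau> + 1) * Z" using t Z by (intro mult_le_mono) auto
  then have ptr: "q + S \<le> B" using B(1) by (simp add: base_def q_def)
  then have ptr': "base + t * S + S \<le> B" "base + t * S \<le> B" by (simp_all add: q_def)
  have "Suc t * (n * n) \<le> base" unfolding base_def using t by (intro mult_le_mono1) simp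
  then have wptr: "t * (n * n) + n * n \<le> base" by simp
  have base_B: "base \<le> B" using B(1) by (simp add: base_def)
  have body: "wp ?body (R, M) (t_best + (t_cost + 4)) (\<lambda>(R, M). ?I (Suc y) R M)"
    if y: "y < S" and I: "?I y R M" for y R M
  proof -
    let ?best = "best (\<lambda>x. compatible n K L x y) (dp n K L w t) y S"
    let ?c = "state_cost n K L (\<lambda>i. w (t * (n * n) + i)) y"
    have y_B: "y \<le> Z" "y \<le> B" using y Z Z_B by auto
    have c: "consts R" using I by simp
    have p: "q + y \<le> B" using ptr y by simp
    have dp: "?best + ?c = dp n K L w (Suc t) y" by (simp add: S)
    have dp_B: "?best + ?c \<le> B" unfolding dp using dp_le_B[of "Suc t"] t by simp
    have tab: "table (q + y) = ?best + ?c" unfolding dp q_def by (rule table_dp[OF y])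
    have tail: "wp ?tail (R2, M) 4 (\<lambda>(R, M). ?I (Suc y) R M)"
      if R2: "agree 17 R R2" "R2 18 = ?best" "R2 19 = ?c" for R2
    proof -
      have c2: "consts R2" using consts_agree[OF c R2(1)] by simp
      have v: "R2 12 = q + y" "R2 13 = t" "R2 14 = t * (n * n)"
        "R2 15 = base + t * S" "R2 16 = y" using I agreeD[OF R2(1)] by simp_all
      have mem: "\<forall>a < Suc (q + y). (M(q + y := ?best + ?c)) a = table a"
        using I tab by (auto simp: less_Suc_eq)
      have le: "?best \<le> B" "?c \<le> B" using dp_B by auto
      show ?thesis
        by (rule wp_time, (rule wp_intros(1,5,8) |
          (use mem in \<open>simp add: v R2(2,3) c2 constsD[OF c2] Z_B p y_B le dp_B\<close>; fail))+)
    qed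
    have cost: "wp (cost ;; ?tail) (R1, M) (t_cost + 4) (\<lambda>(R, M). ?I (Suc y) R M)"
      if R1: "agree 17 R R1" "R1 18 = ?best" for R1
    proof (rule wp_Seq, rule wp_mono[OF wp_cost[where y = y and p = "t * (n * n)" and g = "\<lambda>i. w (t * (n * n) + i)"]])
      show "consts R1" using consts_agree[OF c R1(1)] by simp
      show "R1 16 = y" "R1 14 = t * (n * n)" using I agreeD[OF R1(1)] by simp_all
      show "y \<le> Z" by (rule y_B)
      show "t * (n * n) + n * n \<le> B" using wptr base_B by simp
      show "w (t * (n * n) + i) \<le> W" for i by (rule w)
      show "M (t * (n * n) + i) = w (t * (n * n) + i)" if "i < n * n" for i
      proof -
        have "t * (n * n) + i < base" using that wptr by simp
        moreover from this have "t * (n * n) + i < q + y" by (simp add: q_def)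
        ultimately show ?thesis using I by (simp add: table_input)
      qed
      fix s assume s: "case s of (R', M') \<Rightarrow> M' = M \<and> agree 19 R1 R' \<and> R' 19 = ?c"
      obtain R2 M2 where s_eq: "s = (R2, M2)" by (cases s)
      have R2: "M2 = M" "agree 19 R1 R2" "R2 19 = ?c" using s unfolding s_eq by auto
      have "agree 17 R R2" using agree_trans[OF R1(1) R2(2)] by simp
      moreover have "R2 18 = ?best" using agreeD[OF R2(2), of 18] R1(2) by simp
      ultimately show "wp ?tail s 4 (\<lambda>(R, M). ?I (Suc y) R M)"
        unfolding s_eq R2(1) using R2(3) by (intro tail)
    qed simp
    show ?thesis
    proof (rule wp_Seq, rule wp_mono[OF wp_find_best[where y = y and p = "base + t * S" and f = "dp n K L w t"]])
      show "consts R" by (rule c)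
      show "R 15 = base + t * S" "R 16 = y" using I by simp_all
      show "y < S" by (rule y)
      show "base + t * S + S \<le> B" by (rule ptr')
      show "dp n K L w t x \<le> B" for x using dp_le_B[of t] t by simp
      show "M (base + t * S + x) = dp n K L w t x" if "x < S" for x
      proof -
        have "base + t * S + x < q + y" using that by (simp add: q_def)
        then show ?thesis using I table_dp[OF that, of t] by simp
      qed
      fix s assume s: "case s of (R', M') \<Rightarrow> M' = M \<and> agree 17 R R' \<and> R' 18 = ?best"
      then show "wp (cost ;; ?tail) s (t_cost + 4) (\<lambda>(R, M). ?I (Suc y) R M)"
        using cost by (cases s) simp
    qed simp
  qed
  let ?next = "\<lambda>s. wp (Op (Add 13 13 6)) s 1 (\<lambda>(R, M). at_layer (Suc t) R M)"
  have end_: "wp ?end (R, M) 2 ?next"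
    if I: "?I S R M" for R M
  proof -
    have c: "consts R" using I by simp
    have le: "t * (n * n) \<le> B" "t \<le> B" using wptr base_B t Z_B by auto
    have mem: "\<forall>a < base + Suc (Suc t) * S. M a = table a" using I by (simp add: q_def add_ac)
    have q: "q + S = base + Suc (Suc t) * S" "base + t * S + S = base + Suc t * S"
      "t * (n * n) + n * n = Suc t * (n * n)" by (simp_all add: q_def)
    show ?thesis
      unfolding at_layer_def
      by (rule wp_time, (rule wp_Seq wp_Add |
        (use I mem q in \<open>simp add: constsD[OF c] Z_B le ptr' del: mult_Suc\<close>; fail))+)
  qed
  have loop: "wp (While 16 9 ?body) (R, M) (S * (1 + (t_best + (t_cost + 4))) + 1)
      (\<lambda>s. wp ?end s 2 ?next)" if "?I 0 R M" for R M
  proof (rule wp_While[where I = ?I])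
    fix y R M assume y: "y < S" and I: "?I y R M"
    then show "R 16 < R 9 \<and> R 9 \<le> B \<and> wp ?body (R, M) (t_best + (t_cost + 4)) (\<lambda>(R, M). ?I (Suc y) R M)"
      using body[OF y I] constsD[of R] Z_B by simp
  next
    fix R M assume I: "?I S R M"
    then show "\<not> R 16 < R 9 \<and> R 9 \<le> B \<and> wp ?end (R, M) 2 ?next"
      using end_[OF I] constsD[of R] Z_B by simp
  qed (rule that)
  have init: "?I 0 (R(16 := 0)) M" using at by (simp add: at_layer_def q_def)
  have time: "1 + (S * (1 + (t_best + (t_cost + 4))) + 1 + 2) \<le> t_layer"
  proof -
    have "S * (1 + (t_best + (t_cost + 4))) \<le> Z * (t_best + t_cost + 5)"
      by (rule mult_le_mono) (use Z in auto)
    then show ?thesis unfolding t_layer_def by linarith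
  qed
  show ?thesis
    by (rule wp_Seq, rule wp_time[OF _ time], unfold layer_def, rule wp_Seq, rule wp_Const, rule Z_B(7),
      rule wp_Seq, rule loop, rule init)
qed

lemma wp_layers:
  assumes "at_layer 0 R M"
  shows "wp (While 13 1 (layer ;; Op (Add 13 13 6))) (R, M) (\<tau> * (t_layer + 2) + 1)
    (\<lambda>(R, M). at_layer \<tau> R M)"
proof (rule wp_time, rule wp_While[where I = at_layer])
  fix t R M assume "t < \<tau>" "at_layer t R M"
  then show "R 13 < R 1 \<and> R 1 \<le> B \<and>
      wp (layer ;; Op (Add 13 13 6)) (R, M) (t_layer + 1) (\<lambda>(R, M). at_layer (Suc t) R M)"
    using wp_layer Z_B by (auto simp: at_layer_def consts_def)
next
  fix R M assume "at_layer \<tau> R M"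
  then show "\<not> R 13 < R 1 \<and> R 1 \<le> B \<and> (case (R, M) of (R, M) \<Rightarrow> at_layer \<tau> R M)"
    using Z_B by (auto simp: at_layer_def consts_def)
qed (use assms in auto)

text \<open>Comparing \<alpha> with an entry costs no more than the length of the entry, however
  large \<alpha> is. The flag is set when \<alpha> is not smaller.\<close>

lemma wp_search:
  assumes "at_layer \<tau> R M"
  shows "wp search (R, M) (9 * Z + 3)
    (\<lambda>(R, M). R 5 = 0 \<and> (0 < R 19 \<longleftrightarrow> (\<exists>x<S. dp n K L w \<tau> x \<le> \<alpha>)))"
proof -
  define p where "p = base + \<tau> * S"
  have pS: "p + S \<le> B"
  proof -
    have "(\<tau> + 1) * S \<le> (\<tau> + 2) * Z" by (rule mult_le_mono) (use Z in auto)
    then show ?thesis using B(1) by (simp add: p_def base_def)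
  qed
  let ?I = "\<lambda>x R' M'. M' = M \<and> consts R' \<and> R' 15 = p \<and> R' 16 = x \<and>
    R' 19 = (if \<exists>y<x. dp n K L w \<tau> y \<le> \<alpha> then 1 else 0)"
  let ?body = "Op (Add 28 15 16) ;; Op (Load 28 28) ;; If 4 28 Skip (Op (Const 19 1)) ;; Op (Add 16 16 6)"
  let ?Q = "\<lambda>(R, M). R 5 = 0 \<and> (0 < R 19 \<longleftrightarrow> (\<exists>x<S. dp n K L w \<tau> x \<le> \<alpha>))"
  have mem: "M (p + x) = dp n K L w \<tau> x" if "x < S" for x
    using assms table_dp[OF that, of \<tau>] that by (simp add: at_layer_def p_def)
  have body: "wp ?body (R', M) 8 (\<lambda>(R', M'). ?I (Suc x) R' M')" if x: "x < S" and I: "?I x R' M" for x R'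
  proof -
    have c: "consts R'" using I by simp
    have le: "p \<le> B" "p + x \<le> B" "x \<le> B" "dp n K L w \<tau> x \<le> B" using pS x dp_le_B by auto
    show ?thesis
      by (rule wp_time, (rule wp_intros(1-5,7) |
        (use I in \<open>simp add: constsD[OF c] mem[OF x] le Z_B less_Suc_eq split: if_splits\<close>; fail) |
        (use I in \<open>auto simp add: constsD[OF c] mem[OF x] le Z_B less_Suc_eq split: if_splits\<close>; fail))+)
  qed
  have loop: "wp (While 16 9 ?body) (R', M) (S * (1 + 8) + 1) ?Q" if "?I 0 R' M" for R'
  proof (rule wp_While[where I = ?I])
    fix x R' M' assume x: "x < S" and I: "?I x R' M'"
    then show "R' 16 < R' 9 \<and> R' 9 \<le> B \<and> wp ?body (R', M') 8 (\<lambda>(R', M'). ?I (Suc x) R' M')"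
      using body[OF x, of R'] constsD[of R'] Z_B by simp
  next
    fix R' M' assume I: "?I S R' M'"
    then show "\<not> R' 16 < R' 9 \<and> R' 9 \<le> B \<and> ?Q (R', M')"
      using constsD[of R'] Z_B by simp
  qed (rule that)
  have init: "?I 0 (R(16 := 0, 19 := 0)) M" using assms by (simp add: at_layer_def p_def)
  have time: "1 + (1 + (S * (1 + 8) + 1)) \<le> 9 * Z + 3" using Z by simp
  show ?thesis
    by (rule wp_time[OF _ time], unfold search_def, rule wp_Seq, rule wp_Const, rule Z_B(7),
      rule wp_Seq, rule wp_Const, rule Z_B(7), rule loop, rule init)
qed

section \<open>Preparation and the whole program\<close>

lemma KL_le: "K * L \<le> Z"
proof -
  have "K * L \<le> S"
    unfolding S using pos by (intro self_le_power) auto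
  then show ?thesis using Z by simp
qed

definition "t_prepare = 3 * \<tau> + Z * (3 * Z + 6) + 12 * Z + 40"

text \<open>Register 8 holds \<open>n * L\<close> before it is cut down to \<open>K\<close>, so
  \<open>n * L\<close> itself must be bounded. The zeros of \<open>M\<close> behind the input become
  row 0.\<close>

lemma wp_prepare:
  assumes R: "R 0 = n" "R 1 = \<tau>" "R 2 = k" "R 3 = l" "R 4 = \<alpha>" "R 5 = 0" "R 6 = 1" "R 8 = 0" "R 10 = 0" "R 11 = 0" "R 12 = 0"
    and KL: "L = min l \<tau> + 1" "K = min k (n * L)" and nL: "n * L \<le> Z"
    and M: "\<And>a. M a = (if a < \<tau> * (n * n) then w a else 0)"
  shows "wp prepare (R, M) t_prepare (\<lambda>(R, M). at_layer 0 R M)"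
proof -
  let ?I = "\<lambda>i (R' :: nat \<Rightarrow> nat) M'. M' = M \<and> R' 0 = n \<and> R' 1 = \<tau> \<and> R' 4 = \<alpha> \<and> R' 5 = 0 \<and> R' 6 = 1 \<and> R' 7 = L \<and>
    R' 8 = K \<and> R' 9 = (K * L) ^ i \<and> R' 10 = 0 \<and> R' 11 = 0 \<and> R' 12 = K * L \<and> R' 13 = i"
  let ?body = "Op (Const 14 0) ;; muladd 14 9 12 15 ;; Op (Add 9 14 5) ;; Op (Add 13 13 6)"
  let ?tail = "muladd 11 0 0 13 ;; muladd 10 11 1 13 ;;
     Op (Add 12 10 9) ;; Op (Const 13 0) ;; Op (Const 14 0) ;; Op (Add 15 10 5)"
  let ?init1 = "muladd 8 0 7 13 ;; If 2 8 (Op (Add 8 2 5)) Skip ;; muladd 12 8 7 13 ;;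
     Op (Const 9 1) ;; Op (Const 13 0) ;; While 13 0 ?body ;; ?tail"
  have le: "K * L \<le> B" "n * L \<le> B" "base \<le> B" "base + S \<le> B"
    using KL_le nL Z_B B(1) Z by (auto simp: base_def)
  have pow: "(K * L) ^ i \<le> B" if "i \<le> n" for i
    using power_increasing[OF that, of "K * L"] pos S Z_B by (simp add: Suc_le_eq)
  have tail: "wp ?tail (R', M) (3 * n + 2 + (3 * \<tau> + 2 + 4)) (\<lambda>(R, M). at_layer 0 R M)"
    if I: "?I n R' M" for R'
  proof -
    have mem: "M a = table a" if "a < base + S" for a
      using that M pos by (auto simp: table_def base_def)
    have base_eq: "n * n * \<tau> = base" by (simp add: base_def)
    show ?thesis
      by (rule wp_time, (rule wp_intros(1,4,5) wp_muladd[where i = 11 and a = 0 and x = n and y = n]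
          wp_muladd[where i = 10 and a = 0 and x = "n * n" and y = \<tau>] |
        (use I le mem in \<open>simp add: at_layer_def consts_def S[symmetric] base_eq Z_B\<close>; fail))+)
  qed
  have body: "wp ?body (R', M) (1 + (3 * (K * L) + 2 + 2)) (\<lambda>(R', M'). ?I (Suc i) R' M')"
    if i: "i < n" and I: "?I i R' M" for i R'
  proof -
    have p: "(K * L) ^ i * (K * L) \<le> B" "(K * L) ^ i \<le> B" "i \<le> B" using pow[of "Suc i"] pow[of i] i Z_B
      by (auto simp: mult.commute)
    show ?thesis
      by (rule wp_time, (rule wp_intros(1,4,5) wp_muladd[where a = 0 and x = "(K * L) ^ i" and y = "K * L"] |
        (use I in \<open>simp add: p le Z_B\<close>; fail) | (use I p le Z_B in \<open>simp add: mult.commute\<close>; fail))+)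
  qed
  have loop: "wp (While 13 0 ?body) (R', M) (n * (1 + (1 + (3 * (K * L) + 2 + 2))) + 1)
      (\<lambda>s. wp ?tail s (3 * n + 2 + (3 * \<tau> + 2 + 4)) (\<lambda>(R, M). at_layer 0 R M))" if "?I 0 R' M" for R'
  proof (rule wp_While[where I = ?I])
    fix i R' M' assume i: "i < n" and I: "?I i R' M'"
    then show "R' 13 < R' 0 \<and> R' 0 \<le> B \<and>
        wp ?body (R', M') (1 + (3 * (K * L) + 2 + 2)) (\<lambda>(R', M'). ?I (Suc i) R' M')"
      using body[OF i, of R'] Z_B by simp
  next
    fix R' M' assume I: "?I n R' M'"
    then show "\<not> R' 13 < R' 0 \<and> R' 0 \<le> B \<and> wp ?tail (R', M') (3 * n + 2 + (3 * \<tau> + 2 + 4)) (\<lambda>(R, M). at_layer 0 R M)"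
      using tail[of R'] Z_B by simp
  qed (rule that)
  have L: "wp (If 3 1 (Op (Add 7 3 6)) (Op (Add 7 1 6))) (R, M) 3 (\<lambda>s. s = (R(7 := L), M))"
  proof -
    have l_B: "l < \<tau> \<Longrightarrow> l \<le> B" using Z_B by simp
    show ?thesis
      by (rule wp_time, (rule wp_intros(2,5) | (use R in \<open>simp add: KL(1) Z_B l_B\<close>; fail))+)
  qed
  have K: "wp (If 2 8 (Op (Add 8 2 5)) Skip) (R', M) 3 (\<lambda>s. s = (R'(8 := K), M))"
    if R': "R' 2 = k" "R' 5 = 0" "R' 8 = n * L" for R'
  proof -
    have k_B: "k < n * L \<Longrightarrow> k \<le> B" using le by simp
    have skip: "R'(8 := K) = R'" if "\<not> k < n * L"
      using that R' KL(2) by (simp add: fun_upd_idem_iff)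
    have upd: "k < n * L \<Longrightarrow> K = k" using KL(2) by simp
    show ?thesis
      by (rule wp_time, (rule wp_intros(2,3,5) | (simp add: R' le Z_B k_B; fail) | (simp add: R' skip upd; fail))+)
  qed
  let ?mid = "muladd 12 8 7 13 ;; Op (Const 9 1) ;; Op (Const 13 0) ;; While 13 0 ?body ;; ?tail"
  let ?t = "3 * L + 2 + (1 + (1 + (n * (1 + (1 + (3 * (K * L) + 2 + 2))) + 1 + (3 * n + 2 + (3 * \<tau> + 2 + 4)))))"
  have mid: "wp ?mid (R', M) ?t (\<lambda>(R, M). at_layer 0 R M)"
    if "R' = R(7 := L, 8 := n * L, 13 := L, 8 := K)" for R'
    unfolding that
    by (rule loop wp_intros(1,4) wp_muladd[where a = 0 and x = K and y = L] |
        (use R le in \<open>simp add: Z_B\<close>; fail))+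
  have K': "wp (If 2 8 (Op (Add 8 2 5)) Skip ;; ?mid) (R(7 := L, 8 := 0 + n * L, 13 := L), M) (3 + ?t)
      (\<lambda>(R, M). at_layer 0 R M)"
    by (rule wp_Seq, rule wp_mono[OF K]) (use R mid in auto)
  have mul: "wp (muladd 8 0 7 13 ;; If 2 8 (Op (Add 8 2 5)) Skip ;; ?mid) (R(7 := L), M)
      (3 * L + 2 + (3 + ?t)) (\<lambda>(R, M). at_layer 0 R M)"
    by (rule wp_Seq, rule wp_muladd[where a = 0 and x = n and y = L])
      (use R le K' Z_B in simp_all)
  have "n * (1 + (1 + (3 * (K * L) + 2 + 2))) \<le> Z * (3 * Z + 6)"
    by (rule mult_le_mono) (use Z KL_le in auto)
  then have time: "3 + (3 * L + 2 + (3 + ?t)) \<le> t_prepare"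
    unfolding t_prepare_def using Z by linarith
  show ?thesis
    unfolding prepare_def
    by (rule wp_time[OF _ time], rule wp_Seq, rule wp_mono[OF L]) (use mul in auto)
qed

definition "t_total = t_prepare + \<tau> * (t_layer + 2) + 9 * Z + 8"

lemma wp_solver:
  assumes R: "R = cells [n, \<tau>, k, l, \<alpha>]"
    and KL: "L = min l \<tau> + 1" "K = min k (n * L)" and nL: "n * L \<le> Z"
    and M: "\<And>a. M a = (if a < \<tau> * (n * n) then w a else 0)"
  shows "wp solver (R, M) t_total
    (\<lambda>(R, M). R 5 = 0 \<and> (0 < R 19 \<longleftrightarrow> (\<exists>x<S. dp n K L w \<tau> x \<le> \<alpha>)))"
proof -
  let ?R = "R(6 := 1)"
  have R': "?R 0 = n" "?R 1 = \<tau>" "?R 2 = k" "?R 3 = l" "?R 4 = \<alpha>" "?R 5 = 0" "?R 6 = 1"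
    "?R 8 = 0" "?R 10 = 0" "?R 11 = 0" "?R 12 = 0"
    by (simp_all add: R cells_def)
  have k: "0 < k" using KL(2) pos by simp
  have main: "wp (prepare ;; While 13 1 (layer ;; Op (Add 13 13 6)) ;; search) (?R, M)
      (t_prepare + ((\<tau> * (t_layer + 2) + 1) + (9 * Z + 3)))
      (\<lambda>(R, M). R 5 = 0 \<and> (0 < R 19 \<longleftrightarrow> (\<exists>x<S. dp n K L w \<tau> x \<le> \<alpha>)))"
  proof (rule wp_Seq, rule wp_mono[OF wp_prepare[OF R' KL nL M]])
    fix s assume "case s of (R, M) \<Rightarrow> at_layer 0 R M"
    then obtain R0 M0 where s: "s = (R0, M0)" "at_layer 0 R0 M0" by (cases s) auto
    show "wp (While 13 1 (layer ;; Op (Add 13 13 6)) ;; search) s (\<tau> * (t_layer + 2) + 1 + (9 * Z + 3))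
      (\<lambda>(R, M). R 5 = 0 \<and> (0 < R 19 \<longleftrightarrow> (\<exists>x<S. dp n K L w \<tau> x \<le> \<alpha>)))"
      unfolding s(1) by (rule wp_Seq, rule wp_mono[OF wp_layers[OF s(2)]]) (auto intro: wp_search)
  qed simp
  have time: "1 + (1 + (1 + (1 + (t_prepare + ((\<tau> * (t_layer + 2) + 1) + (9 * Z + 3)))))) \<le> t_total"
    by (simp add: t_total_def)
  show ?thesis
    unfolding solver_def
    by (rule wp_time[OF _ time], (rule main wp_IfTrue wp_Seq wp_Const |
      (use R' k pos Z_B in simp; fail))+)
qed

text \<open>The four factors \<open>Z\<close> come from the nested loops over new states, old states
  and vertices, and from the repeated subtraction inside; computing the costs is of the same order,
  with a second vertex instead of the old state.\<close>

lemma t_total_le: "t_total \<le> 1000 * (\<tau> * Z ^ 4)"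
proof -
  have Z1: "1 \<le> Z" using pos Z by simp
  have pw: "1 \<le> Z ^ 4" "Z \<le> Z ^ 4" "Z ^ 2 \<le> Z ^ 4" "Z ^ 3 \<le> Z ^ 4"
    using Z1 power_increasing[of 0 4 Z] power_increasing[of 1 4 Z] power_increasing[of 2 4 Z]
      power_increasing[of 3 4 Z] by auto
  have layer: "t_layer = 21 * Z ^ 4 + 46 * Z ^ 3 + 28 * Z ^ 2 + 15 * Z + 4"
    unfolding t_layer_def t_best_def t_cost_def t_check_def t_row_def
    by (simp add: algebra_simps power2_eq_square power3_eq_cube power4_eq_xxxx)
  have "t_layer + 2 \<le> 120 * Z ^ 4" unfolding layer using pw by linarith
  then have 1: "\<tau> * (t_layer + 2) \<le> \<tau> * (120 * Z ^ 4)" by (rule mult_le_mono2)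
  have "1 * Z ^ 4 \<le> \<tau> * Z ^ 4" using pos by (intro mult_le_mono1) simp
  moreover have "\<tau> * 1 \<le> \<tau> * Z ^ 4" using pw by (intro mult_le_mono2) simp
  moreover have "t_prepare = 3 * \<tau> + 3 * Z ^ 2 + 18 * Z + 40"
    unfolding t_prepare_def by (simp add: algebra_simps power2_eq_square)
  ultimately show ?thesis unfolding t_total_def using 1 pw by linarith
qed

end

section \<open>Instances without vertices, ranks or time steps\<close>

lemma (in machine) wp_solver_trivial:
  assumes "1 \<le> B" and R: "R = cells [n, \<tau>, k, l, \<alpha>]" and triv: "n = 0 \<or> k = 0 \<or> \<tau> = 0"
  shows "wp solver (R, M) 10
    (\<lambda>(R, M). R 5 = 0 \<and> (0 < R 19 \<longleftrightarrow> n = 0 \<or> 0 < k \<and> l = 0))"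
proof -
  have R': "R 0 = n" "R (Suc 0) = \<tau>" "R 2 = k" "R 3 = l" "R 5 = 0" "R 19 = 0"
    by (simp_all add: R cells_def)
  note facts = R' assms(1)
  consider "n = 0" | "0 < n" "k = 0" | "0 < n" "0 < k" "\<tau> = 0" "l = 0"
    | "0 < n" "0 < k" "\<tau> = 0" "0 < l"
    using triv by auto
  then show ?thesis
  proof cases
    case 1
    show ?thesis
      unfolding solver_def
      by (rule wp_time, (rule wp_Seq wp_Const wp_Skip |
        (rule wp_IfTrue, (use 1 facts in simp; fail)) |
        (rule wp_IfFalse, (use 1 facts in simp; fail)) | (use 1 facts in simp; fail))+)
  next
    case 2
    show ?thesis
      unfolding solver_def
      by (rule wp_time, (rule wp_Seq wp_Const wp_Skip |
        (rule wp_IfTrue, (use 2 facts in simp; fail)) |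
        (rule wp_IfFalse, (use 2 facts in simp; fail)) | (use 2 facts in simp; fail))+)
  next
    case 3
    show ?thesis
      unfolding solver_def
      by (rule wp_time, (rule wp_Seq wp_Const wp_Skip |
        (rule wp_IfTrue, (use 3 facts in simp; fail)) |
        (rule wp_IfFalse, (use 3 facts in simp; fail)) | (use 3 facts in simp; fail))+)
  next
    case 4
    show ?thesis
      unfolding solver_def
      by (rule wp_time, (rule wp_Seq wp_Const wp_Skip |
        (rule wp_IfTrue, (use 4 facts in simp; fail)) |
        (rule wp_IfFalse, (use 4 facts in simp; fail)) | (use 4 facts in simp; fail))+)
  qed
qed

text \<open>Without vertices all conditions are vacuous. A vertex needs a rank in
  \<open>{1..k}\<close> even if there is no time step, and with \<open>l > 0\<close> also change
  points in \<open>{1..lifetime G}\<close>, which is empty for lifetime 0.\<close>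

lemma seg_agony_trivial:
  assumes "temporal_wdigraph G" and "card (verts G) = 0 \<or> k = 0 \<or> lifetime G = 0"
  shows "seg_agony G k l \<alpha> \<longleftrightarrow> card (verts G) = 0 \<or> 0 < k \<and> l = 0"
proof (cases "card (verts G) = 0")
  case True
  then have V: "verts G = {}" using assms(1) by (simp add: temporal_wdigraph_def)
  then have "temporal_agony (\<lambda>_ _. 0) G linear_penalty = 0"
    using assms(1) by (auto simp: temporal_agony_def temporal_wdigraph_def)
  moreover have "rank_segmentation (verts G) (lifetime G) k l (\<lambda>_ _. 0)"
    by (simp add: rank_segmentation_def V)
  ultimately show ?thesis using True unfolding seg_agony_def by (metis zero_le)
next
  case False
  then obtain v where v: "v \<in> verts G" by fastforce
  show ?thesis
  proof (cases "k = 0")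
    case True
    then show ?thesis using v False unfolding seg_agony_def rank_segmentation_def by fastforce
  next
    case k: False
    then have \<tau>: "lifetime G = 0" using assms(2) False by simp
    have "rank_segmentation (verts G) 0 k 0 (\<lambda>_ _. 1)"
      using k by (auto simp: rank_segmentation_def intro!: exI[of _ "\<lambda>_ _. 1"])
    moreover have "\<not> rank_segmentation (verts G) 0 k l r" if "0 < l" for r
      using v that unfolding rank_segmentation_def by fastforce
    moreover have "temporal_agony r G linear_penalty = 0" for r
      by (simp add: temporal_agony_def \<tau>)
    ultimately show ?thesis
      using False k unfolding seg_agony_def \<tau> by (cases "l = 0") auto
  qed
qed

section \<open>Word lengths and the size of the state space\<close>

lemma num_words_mono: "x \<le> y \<Longrightarrow> num_words b x \<le> num_words b y"
  unfolding num_words_def by (intro max.mono floorlog_mono) auto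

text \<open>A number of \<open>m\<close> bits fits into \<open>m\<close> words of any positive
  length, and the factor \<open>2 ^ b\<close> takes one more word. The crude
  \<open>2 * Z < 2 ^ (Z + 1)\<close> costs only a factor that is polynomial in
  \<open>Z\<close>.\<close>

lemma num_words_bound:
  assumes "1 \<le> b"
  shows "num_words b (2 ^ b * (W * (2 * Z))) \<le> floorlog 2 W + Z + 2"
proof -
  have W: "W < 2 ^ floorlog 2 W" by (rule floorlog_leD) auto
  have Z: "2 * Z < 2 ^ (Z + 1)" by (simp add: less_exp)
  have "W * (2 * Z) < 2 ^ floorlog 2 W * 2 ^ (Z + 1)"
    by (rule mult_strict_mono[OF W Z]) auto
  also have "\<dots> = 2 ^ (floorlog 2 W + Z + 1)" by (simp add: power_add)
  also have "\<dots> \<le> 2 ^ (b * (floorlog 2 W + Z + 1))"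
    using assms mult_le_mono1[of 1 b "floorlog 2 W + Z + 1"] by (intro power_increasing) simp_all
  finally have "2 ^ b * (W * (2 * Z)) < 2 ^ b * 2 ^ (b * (floorlog 2 W + Z + 1))" by simp
  also have "\<dots> = (2 ^ b) ^ (floorlog 2 W + Z + 2)" by (simp add: power_mult[symmetric] power_add[symmetric])
  finally have "floorlog (2 ^ b) (2 ^ b * (W * (2 * Z))) \<le> floorlog 2 W + Z + 2"
    using one_less_power[of "2 :: nat" b] assms by (intro floorlog_leI) simp_all
  then show ?thesis by (simp add: num_words_def)
qed

lemma floorlog_le_log: "1 \<le> W \<Longrightarrow> real (floorlog 2 W) \<le> 1 + log 2 (real W)"
  by (simp add: floorlog_def)

lemma finite_weights:
  assumes "temporal_wdigraph G"
  shows "finite (insert 1 (\<Union>t\<in>{1..lifetime G}. weight G t ` arcs G t))"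
proof -
  have "finite (arcs G t)" if "t \<in> {1..lifetime G}" for t
    using assms that finite_subset[of "arcs G t" "verts G \<times> verts G"]
    by (auto simp: temporal_wdigraph_def)
  then show ?thesis by auto
qed

lemma max_weight_pos: "temporal_wdigraph G \<Longrightarrow> 1 \<le> max_weight G"
  unfolding max_weight_def by (rule Max_ge[OF finite_weights]) auto

lemma weight_le_max_weight:
  assumes "temporal_wdigraph G"
  shows "cells (weight_list G) i \<le> max_weight G"
proof -
  have "x \<le> max_weight G" if "x \<in> set (weight_list G)" for x
  proof (cases "x = 0")
    case False
    then show ?thesis
      unfolding max_weight_def using that
      by (intro Max_ge[OF finite_weights[OF assms]]) (auto simp: weight_list_def split: if_splits)
  qed simp
  then show ?thesis by (simp add: cells_def)
qed

text \<open>From \<open>L \<le> l + 1\<close>, which is at most \<open>2 * max 1 l\<close>, and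
  \<open>K \<le> n * L\<close> it follows that \<open>K * L\<close> is at most the base of this
  power. The maximum keeps it positive for \<open>l = 0\<close>, where the program must still answer
  correctly.\<close>

definition state_bound :: "nat \<Rightarrow> nat \<Rightarrow> nat" where
  "state_bound n l = (4 * n * (max 1 l)\<^sup>2) ^ n"

lemma state_bound_ge:
  assumes "1 \<le> n" "K \<le> n * L" "L \<le> l + 1"
  shows "n \<le> state_bound n l" "L \<le> state_bound n l" "n * L \<le> state_bound n l"
    "(K * L) ^ n \<le> state_bound n l"
proof -
  let ?m = "max 1 l"
  have m: "1 \<le> ?m\<^sup>2" "?m \<le> ?m\<^sup>2" by (rule one_le_power, simp, rule self_le_power, simp_all)
  have L: "L \<le> 2 * ?m" using assms(3) by auto
  have "4 * n * ?m\<^sup>2 \<le> state_bound n l"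
    unfolding state_bound_def by (rule self_le_power) (use assms(1) m in auto)
  then have n4: "n * (4 * ?m\<^sup>2) \<le> state_bound n l" by (simp add: mult.assoc mult.left_commute)
  have "n * L \<le> n * (4 * ?m\<^sup>2)" using L m(2) by (intro mult_le_mono2) linarith
  then show nL: "n * L \<le> state_bound n l" using n4 by (rule order_trans)
  have "L \<le> n * L" using assms(1) by simp
  then show "L \<le> state_bound n l" using nL by linarith
  have "n * 1 \<le> n * (4 * ?m\<^sup>2)" using m by (intro mult_le_mono2) linarith
  then show "n \<le> state_bound n l" using n4 by linarith
  have "K * L \<le> n * L * L" using assms(2) by simp
  also have "\<dots> \<le> n * (2 * ?m) * (2 * ?m)" using L by (intro mult_le_mono) auto
  also have "\<dots> = 4 * n * ?m\<^sup>2" by (simp add: power2_eq_square)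
  finally show "(K * L) ^ n \<le> state_bound n l" unfolding state_bound_def by (rule power_mono) simp
qed

lemma state_bound_pos: "1 \<le> n \<Longrightarrow> 1 \<le> state_bound n l"
  unfolding state_bound_def by (simp add: Suc_le_eq)

text \<open>If \<open>l * n\<close> is at least 2, its square absorbs the factor 4, and the exponent
  is \<open>4 * n * 5\<close>. In the remaining case \<open>l = n = 1\<close> the bound is 4, and
  \<open>4 ^ 5 = 1024\<close>.\<close>

lemma state_bound_le:
  assumes "1 \<le> n" "1 \<le> l"
  shows "state_bound n l ^ 5 \<le> 1024 * (l * n) ^ (20 * n)"
proof (cases "l * n = 1")
  case True
  then show ?thesis by (simp add: state_bound_def)
next
  case False
  then have "2 \<le> l * n" using assms by (cases "l * n") auto
  then have "2 ^ 2 \<le> (l * n) ^ 2" by (rule power_mono) simp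
  moreover have "n * l\<^sup>2 \<le> (l * n)\<^sup>2" using assms by (simp add: power2_eq_square)
  ultimately have "2 ^ 2 * (n * l\<^sup>2) \<le> (l * n)\<^sup>2 * (l * n)\<^sup>2" by (rule mult_le_mono)
  then have "4 * n * l\<^sup>2 \<le> (l * n) ^ 4" by (simp add: power_add[symmetric])
  then have "state_bound n l \<le> ((l * n) ^ 4) ^ n"
    unfolding state_bound_def using assms(2) by (intro power_mono) (auto simp: max_def)
  then have "state_bound n l ^ 5 \<le> (((l * n) ^ 4) ^ n) ^ 5" by (rule power_mono) simp
  also have "\<dots> = (l * n) ^ (20 * n)" by (simp add: power_mult[symmetric])
  finally show ?thesis by simp
qed

lemma solver_correct:
  fixes G :: "nat tgraph" and k l \<alpha> b :: nat
  assumes G: "temporal_wdigraph G" and len: "input_length G \<le> 2 ^ b"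
    and "1 \<le> card (verts G)" "1 \<le> lifetime G" "1 \<le> k"
  defines "Z \<equiv> state_bound (card (verts G)) l"
  shows "\<exists>R M R' M' m. (0, R, M) = initial_config G k l \<alpha> \<and> exec b solver (R, M) m (R', M') \<and>
    R' 5 = 0 \<and> (0 < R' 19 \<longleftrightarrow> seg_agony G k l \<alpha>) \<and>
    m \<le> (2 * (floorlog 2 (max_weight G) + Z + 2) + 1) * (1000 * (lifetime G * Z ^ 4))"
proof -
  define n \<tau> W where "n = card (verts G)" and "\<tau> = lifetime G" and "W = max_weight G"
  define L K where "L = num_stages G l" and "K = num_ranks G k l"
  define w where "w = cells (weight_list G)"
  \<comment> \<open>The length of the input is at most \<open>2 ^ b\<close>, so this factor bounds
    both \<open>\<tau> * (n * n)\<close> and \<open>\<tau> + 2\<close>; the factor 2 makes room for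
    input and table together.\<close>
  define B where "B = 2 ^ b * (W * (2 * Z))"
  have n\<tau>: "1 \<le> n" "1 \<le> \<tau>" using assms by (simp_all add: n_def \<tau>_def)
  have KL: "L = min l \<tau> + 1" "K = min k (n * L)"
    by (simp_all add: L_def K_def num_stages_def num_ranks_def \<tau>_def n_def)
  have b: "\<tau> * (n * n) + 5 \<le> 2 ^ b"
    using len by (simp add: input_length_def length_weight_list n_def \<tau>_def)
  then have "1 \<le> b" by (cases b) auto
  have W: "1 \<le> W" and w: "w i \<le> W" for i
    using max_weight_pos[OF G] weight_le_max_weight[OF G] by (simp_all add: W_def w_def)
  have Z_ge: "n \<le> Z" "L \<le> Z" "n * L \<le> Z" "(K * L) ^ n \<le> Z"
    using state_bound_ge[of n K L l] n\<tau> KL by (auto simp: Z_def n_def)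
  have "K \<le> n * L" using KL(2) by simp
  then have "K \<le> Z" using Z_ge(3) by (rule order_trans)
  have "1 \<le> Z" using n\<tau> Z_ge by linarith
  have B1: "\<tau> * (n * n) + (\<tau> + 2) * Z + 2 \<le> B"
  proof -
    have "\<tau> * 1 \<le> \<tau> * (n * n)" using n\<tau> by (intro mult_le_mono2) simp
    then have "(\<tau> + 2) * Z \<le> 2 ^ b * Z" using b by (intro mult_le_mono1) linarith
    moreover have "(\<tau> * (n * n) + 2) * 1 \<le> 2 ^ b * Z" using b \<open>1 \<le> Z\<close> by (intro mult_le_mono) auto
    ultimately have "\<tau> * (n * n) + (\<tau> + 2) * Z + 2 \<le> 2 ^ b * (1 * (2 * Z))" by simp
    also have "\<dots> \<le> B" unfolding B_def using W by (intro mult_le_mono) auto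
    finally show ?thesis .
  qed
  have B2: "\<tau> * (n * n * W * Z) \<le> B"
  proof -
    have "\<tau> * (n * n * W * Z) = \<tau> * (n * n) * (W * Z)" by simp
    also have "\<dots> \<le> 2 ^ b * (W * (2 * Z))" using b by (intro mult_le_mono) auto
    finally show ?thesis by (simp add: B_def)
  qed
  define u where "u = 2 * (floorlog 2 W + Z + 2) + 1"
  have pos: "0 < n" "0 < \<tau>" "0 < L" "0 < K"
    using n\<tau> KL assms(5) by auto
  interpret seg_machine b B u n \<tau> K L "(K * L) ^ n" \<alpha> W Z w
  proof
    fix x assume "x \<le> B"
    then have "num_words b x \<le> num_words b B" by (rule num_words_mono)
    also have "\<dots> \<le> floorlog 2 W + Z + 2" unfolding B_def by (rule num_words_bound) fact
    finally show "2 * num_words b x + 1 \<le> u" by (simp add: u_def)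
  qed (fact pos w Z_ge \<open>K \<le> Z\<close> B1 B2 refl)+
  define R where "R = cells [n, \<tau>, k, l, \<alpha>]"
  have "wp solver (R, w) t_total
      (\<lambda>(R, M). R 5 = 0 \<and> (0 < R 19 \<longleftrightarrow> (\<exists>x<(K * L) ^ n. dp n K L w \<tau> x \<le> \<alpha>)))"
    by (rule wp_solver[OF R_def KL Z_ge(3)])
      (auto simp: w_def cells_def length_weight_list n_def \<tau>_def)
  then obtain m R' M' where "exec b solver (R, w) m (R', M')" "m \<le> u * t_total" "R' 5 = 0"
    "0 < R' 19 \<longleftrightarrow> (\<exists>x<(K * L) ^ n. dp n K L w \<tau> x \<le> \<alpha>)"
    unfolding wp_def by auto
  moreover have "u * t_total \<le> u * (1000 * (\<tau> * Z ^ 4))" using t_total_le by (rule mult_le_mono2)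
  moreover have "seg_agony G k l \<alpha> \<longleftrightarrow> (\<exists>x<(K * L) ^ n. dp n K L w \<tau> x \<le> \<alpha>)"
    unfolding n_def K_def L_def w_def \<tau>_def by (rule seg_agony_iff_dp) (use assms in auto)
  moreover have "(0, R, w) = initial_config G k l \<alpha>"
    by (simp add: initial_config_def R_def w_def n_def \<tau>_def)
  ultimately show ?thesis
    unfolding u_def W_def \<tau>_def by (intro exI[of _ R] exI[of _ w] exI[of _ R'] exI[of _ M'] exI[of _ m]) simp
qed

theorem theorem1:
  shows "\<exists>(P :: program) (C :: nat).
    \<forall>(G :: nat tgraph) (k :: nat) (l :: nat) (\<alpha> :: nat) (b :: nat).
      temporal_wdigraph G \<and> input_length G \<le> 2 ^ b \<longrightarrow>
      (\<exists>T. runs b P (initial_config G k l \<alpha>) (seg_agony G k l \<alpha>) T \<and>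
           (1 \<le> l \<longrightarrow>
              real T \<le> real C * real (max 1 (lifetime G))
                        * real (l * card (verts G)) ^ (C * card (verts G))
                        * max 1 (log 2 (real (max_weight G)))))"
proof -
  \<comment> \<open>\<open>11 Z W'\<close> per unit of time, \<open>1000 \<tau> Z^4\<close> units, \<open>2\<close> for the final answer, and \<open>Z^5 \<le> 1024 (l n)^(20 n)\<close>,
    where \<open>W'\<close> is the logarithmic factor\<close>
  obtain C :: nat where C: "11002 * 1024 \<le> C" by blast
  let ?P = "decision_program solver 5 19"
  have "\<exists>T. runs b ?P (initial_config G k l \<alpha>) (seg_agony G k l \<alpha>) T \<and>
      (1 \<le> l \<longrightarrow> real T \<le> real C * real (max 1 (lifetime G)) *
        real (l * card (verts G)) ^ (C * card (verts G)) * max 1 (log 2 (real (max_weight G))))"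
    if G: "temporal_wdigraph G" and len: "input_length G \<le> 2 ^ b"
    for G :: "nat tgraph" and k l \<alpha> b
  proof -
    let ?n = "card (verts G)" and ?\<tau> = "max 1 (lifetime G)"
    let ?W = "max 1 (log 2 (real (max_weight G)))"
    \<comment> \<open>Without vertices the base is 0, but so is the exponent, and the power is
      1.\<close>
    have pow: "1 \<le> real (l * ?n) ^ (C * ?n)" if "1 \<le> l"
    proof (cases "?n = 0")
      case False
      then have "1 \<le> l * ?n" using that by simp
      then show ?thesis by (intro one_le_power) (simp flip: of_nat_mult)
    qed simp
    show ?thesis
    proof (cases "?n = 0 \<or> k = 0 \<or> lifetime G = 0")
      case True
      have "1 \<le> b" using len by (cases b) (auto simp: input_length_def)
      \<comment> \<open>On these instances the program computes only with 0 and 1, which fit into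
        one word, and each comparison has 0 on one side; the unit is
        \<open>2 * 1 + 1\<close>.\<close>
      interpret machine b 1 3
      proof
        fix x :: nat assume "x \<le> 1"
        moreover have "(1 :: nat) < 2 ^ b" using \<open>1 \<le> b\<close> by (intro one_less_power) auto
        ultimately have "floorlog (2 ^ b) x \<le> 1"
          by (intro floorlog_leI) (simp_all add: le_less_trans)
        then show "2 * num_words b x + 1 \<le> 3" by (simp add: num_words_def)
      qed
      have "wp solver (cells [?n, lifetime G, k, l, \<alpha>], cells (weight_list G)) 10
          (\<lambda>(R, M). R 5 = 0 \<and> (0 < R 19 \<longleftrightarrow> ?n = 0 \<or> 0 < k \<and> l = 0))"
        by (rule wp_solver_trivial[OF _ refl True]) simp
      then obtain m s where s: "exec b solver (cells [?n, lifetime G, k, l, \<alpha>], cells (weight_list G)) m s"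
        "m \<le> 3 * 10" "case s of (R, M) \<Rightarrow> R 5 = 0 \<and> (0 < R 19 \<longleftrightarrow> ?n = 0 \<or> 0 < k \<and> l = 0)"
        unfolding wp_def by (elim exE conjE) (rule that)
      obtain R' M' where s_eq: "s = (R', M')" by (cases s)
      have ex: "exec b solver (cells [?n, lifetime G, k, l, \<alpha>], cells (weight_list G)) m (R', M')"
        and m: "m \<le> 30" and R': "R' 5 = 0" "0 < R' 19 \<longleftrightarrow> ?n = 0 \<or> 0 < k \<and> l = 0"
        using s unfolding s_eq by simp_all
      from runs_decision_program[OF ex R'(1), of 19]
      have "runs b ?P (initial_config G k l \<alpha>) (seg_agony G k l \<alpha>) (m + 2)"
        using seg_agony_trivial[OF G True] R'(2) by (simp add: initial_config_def)
      moreover have "real (m + 2) \<le> real C * real ?\<tau> * real (l * ?n) ^ (C * ?n) * ?W" if "1 \<le> l"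
      proof -
        have "real (m + 2) \<le> real C" using m C by linarith
        also have "real C = real C * 1 * 1 * 1" by simp
        also have "\<dots> \<le> real C * real ?\<tau> * real (l * ?n) ^ (C * ?n) * ?W"
          using pow[OF that] by (intro mult_mono) auto
        finally show ?thesis .
      qed
      ultimately show ?thesis by blast
    next
      case False
      let ?Z = "state_bound ?n l"
      obtain R M R' M' m where init: "(0, R, M) = initial_config G k l \<alpha>"
        and ex: "exec b solver (R, M) m (R', M')" and R': "R' 5 = 0" "0 < R' 19 \<longleftrightarrow> seg_agony G k l \<alpha>"
        and m: "m \<le> (2 * (floorlog 2 (max_weight G) + ?Z + 2) + 1) * (1000 * (lifetime G * ?Z ^ 4))"
        using solver_correct[OF G len, of k l \<alpha>] False by (auto simp: Suc_le_eq)
      from runs_decision_program[OF ex R'(1), of 19]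
      have "runs b ?P (initial_config G k l \<alpha>) (seg_agony G k l \<alpha>) (m + 2)"
        using R'(2) init by simp
      moreover have "real (m + 2) \<le> real C * real ?\<tau> * real (l * ?n) ^ (C * ?n) * ?W" if l: "1 \<le> l"
      proof -
        have n: "1 \<le> ?n" using False by linarith
        have Z: "1 \<le> real ?Z" using state_bound_pos[OF n, of l] by linarith
        have W: "1 \<le> ?W" "real (floorlog 2 (max_weight G)) \<le> 1 + ?W"
          using floorlog_le_log[OF max_weight_pos[OF G]] by auto
        \<comment> \<open>The unit is at most \<open>2 * ?W + 2 * ?Z + 7\<close>; bounding
          \<open>?W\<close>, \<open>?Z\<close> and 1 by \<open>?W * ?Z\<close> gives the factor
          11.\<close>
        have "?W * 1 \<le> ?W * ?Z" "1 * real ?Z \<le> ?W * ?Z"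
          using W Z by (intro mult_left_mono mult_right_mono; simp)+
        moreover from this W Z have "1 \<le> ?W * ?Z" by linarith
        ultimately have u: "real (2 * (floorlog 2 (max_weight G) + ?Z + 2) + 1) \<le> 11 * (?W * real ?Z)"
          using W(2) by simp
        have "real (m + 2) \<le> 11 * (?W * real ?Z) * (1000 * (real ?\<tau> * real ?Z ^ 4)) + 2"
        proof -
          have "real m \<le> real (2 * (floorlog 2 (max_weight G) + ?Z + 2) + 1) * real (1000 * (lifetime G * ?Z ^ 4))"
            using m unfolding of_nat_mult[symmetric] of_nat_le_iff .
          also have "\<dots> \<le> 11 * (?W * real ?Z) * real (1000 * (lifetime G * ?Z ^ 4))"
            using u by (rule mult_right_mono) simp
          also have "real (1000 * (lifetime G * ?Z ^ 4)) = 1000 * (real ?\<tau> * real ?Z ^ 4)"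
            using False by (simp add: max_def Suc_le_eq)
          finally show ?thesis by simp
        qed
        also have "\<dots> = 11000 * (real ?\<tau> * real ?Z ^ 5 * ?W) + 2"
          by (simp add: eval_nat_numeral)
        also have "\<dots> \<le> 11002 * (real ?\<tau> * real ?Z ^ 5 * ?W)"
        proof -
          have "1 * 1 * 1 \<le> real ?\<tau> * real ?Z ^ 5 * ?W"
            using Z W by (intro mult_mono one_le_power) auto
          then show ?thesis by linarith
        qed
        also have "\<dots> \<le> 11002 * (real ?\<tau> * (1024 * real (l * ?n) ^ (C * ?n)) * ?W)"
        proof -
          have "real ?Z ^ 5 \<le> 1024 * real (l * ?n) ^ (20 * ?n)"
            using of_nat_mono[OF state_bound_le[OF n l], where 'a = real]
            by (simp only: of_nat_mult of_nat_power of_nat_numeral)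
          also have "real (l * ?n) ^ (20 * ?n) \<le> real (l * ?n) ^ (C * ?n)"
          proof (rule power_increasing)
            show "20 * ?n \<le> C * ?n" using C by (intro mult_le_mono1) linarith
            have "1 \<le> l * ?n" using l n by simp
            then show "1 \<le> real (l * ?n)" by (simp flip: of_nat_mult)
          qed
          finally show ?thesis using W by (intro mult_left_mono mult_right_mono) auto
        qed
        also have "\<dots> = real (11002 * 1024) * (real ?\<tau> * real (l * ?n) ^ (C * ?n) * ?W)" by simp
        also have "\<dots> \<le> real C * (real ?\<tau> * real (l * ?n) ^ (C * ?n) * ?W)"
          using C W by (intro mult_right_mono) (auto simp only: of_nat_le_iff, simp)
        finally show ?thesis by (simp only: mult.assoc)
      qed
      ultimately show ?thesis by blast
    qed
  qed
  then show ?thesis by blast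
qed

end
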